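(* Let $1\le q\le\infty$, let $\rho>0$, and let $\mathbf{Y}\in\mathbb{C}^{n_1\times n_2}$ have the singular-value decomposition $\mathbf{Y}=\mathbf{U}\boldsymbol{\Sigma}\mathbf{V}^{H}$, where $\mathbf{U}\in\mathbb{U}^{n_1}$, $\mathbf{V}\in\mathbb{U}^{n_2}$ and $\boldsymbol{\Sigma}\in\mathbb{D}^{n_1\times n_2}$. The orthogonal projection of $\mathbf{Y}$ onto the set $\mathcal{B}_{\mathcal{S}_q}=\{\mathbf{X}\in\mathbb{C}^{n_1\times n_2}:\|\mathbf{X}\|_{\mathcal{S}_q}\le\rho\}$ is given by $$\mathcal{P}_{\mathcal{B}_{\mathcal{S}_q}}(\mathbf{Y})=\mathbf{U}\,\mathrm{diag}\big(\mathcal{P}_{\mathcal{B}_q}(\boldsymbol{\sigma}(\mathbf{Y}))\big)\,\mathbf{V}^{H},$$ where $\mathrm{diag}(\cdot)$ is the operator that maps a vector to a diagonal matrix and $\mathcal{P}_{\mathcal{B}_q}$ is the orthogonal projection onto the $\ell_q$ norm ball $\mathcal{B}_q=\{\mathbf{v}\in\mathbb{R}_+^{\min(n_1,n_2)}:\|\mathbf{v}\|_q\le\rho\}$ of radius $\rho$.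
   Context: $\mathbb{U}^n$ is the set of $n\times n$ complex unitary matrices, $(\cdot)^H$ is the Hermitian transpose, $\mathbb{R}_+$ is the set of non-negative reals, and $\mathbb{D}^{n_1\times n_2}=\{\mathbf{X}\in\mathbb{R}_+^{n_1\times n_2}:\mathbf{X}(i,j)=0\ \forall i\ne j\}$. The vector $\boldsymbol{\sigma}(\mathbf{Y})\in\mathbb{R}_+^{\min(n_1,n_2)}$ of singular values of $\mathbf{Y}$ has $k$-th entry $\boldsymbol{\Sigma}(k,k)$. The Schatten norm $\|\mathbf{X}\|_{\mathcal{S}_q}$ is the $\ell_q$ norm of the vector of singular values of $\mathbf{X}$ (for $q=\infty$, the largest singular value). Here $\mathrm{diag}(\mathbf{v})$ is the $n_1\times n_2$ matrix with main diagonal $\mathbf{v}$ and zeros elsewhere. Orthogonal projection of matrices is with respect to the Frobenius norm: $\mathcal{P}_{\mathcal{B}_{\mathcal{S}_q}}(\mathbf{Y})=\arg\min_{\|\mathbf{X}\|_{\mathcal{S}_q}\le\rho}\|\mathbf{X}-\mathbf{Y}\|_F^2$; orthogonal projection of vectors is with respect to the Euclidean norm. *)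

theory Defs
  imports
    "Jordan_Normal_Form.Schur_Decomposition"
    "HOL-Library.Extended_Real"
begin

definition unitary_mats :: "nat \<Rightarrow> complex mat set" where
  "unitary_mats n =
    {U \<in> carrier_mat n n. U * mat_adjoint U = 1\<^sub>m n \<and> mat_adjoint U * U = 1\<^sub>m n}"

text \<open>The diagonal entries below are neither sorted nor required to be positive, so the diagonal
  factor of a singular value decomposition is determined only up to the order of its entries.\<close>

definition nonneg_diag_mats :: "nat \<Rightarrow> nat \<Rightarrow> real mat set" where
  "nonneg_diag_mats n1 n2 =
    {S \<in> carrier_mat n1 n2. diagonal_mat S \<and> (\<forall>i<n1. \<forall>j<n2. 0 \<le> S $$ (i, j))}"

definition is_svd :: "complex mat \<Rightarrow> complex mat \<Rightarrow> real mat \<Rightarrow> complex mat \<Rightarrow> bool" where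
  "is_svd Y U S V \<longleftrightarrow>
    U \<in> unitary_mats (dim_row Y) \<and> V \<in> unitary_mats (dim_col Y) \<and>
    S \<in> nonneg_diag_mats (dim_row Y) (dim_col Y) \<and>
    Y = U * map_mat complex_of_real S * mat_adjoint V"

definition main_diag :: "'a mat \<Rightarrow> 'a vec" where
  "main_diag S = vec (min (dim_row S) (dim_col S)) (\<lambda>k. S $$ (k, k))"

definition diag_of_vec :: "nat \<Rightarrow> nat \<Rightarrow> 'a::zero vec \<Rightarrow> 'a mat" where
  "diag_of_vec n1 n2 v = mat n1 n2 (\<lambda>(i, j). if i = j then v $ i else 0)"

text \<open>The order of the entries depends on the decomposition that is selected; this vector is only
  used inside norms that are invariant under permutation of the entries.\<close>

definition singular_values :: "complex mat \<Rightarrow> real vec" where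
  "singular_values X = main_diag (SOME S. \<exists>U V. is_svd X U S V)"

text \<open>The inserted 0 only matters for the vector of dimension 0.\<close>

definition lq_norm :: "ereal \<Rightarrow> real vec \<Rightarrow> real" where
  "lq_norm q v =
    (if q = \<infinity> then Max (insert 0 ((\<lambda>i. \<bar>v $ i\<bar>) ` {..<dim_vec v}))
     else (\<Sum>i<dim_vec v. \<bar>v $ i\<bar> powr real_of_ereal q) powr (1 / real_of_ereal q))"

definition schatten_norm :: "ereal \<Rightarrow> complex mat \<Rightarrow> real" where
  "schatten_norm q X = lq_norm q (singular_values X)"

definition euclidean_norm :: "real vec \<Rightarrow> real" where
  "euclidean_norm v = sqrt (\<Sum>i<dim_vec v. (v $ i)\<^sup>2)"

definition frobenius_norm :: "complex mat \<Rightarrow> real" where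
  "frobenius_norm A = sqrt (\<Sum>i<dim_row A. \<Sum>j<dim_col A. (cmod (A $$ (i, j)))\<^sup>2)"

definition lq_ball :: "nat \<Rightarrow> ereal \<Rightarrow> real \<Rightarrow> real vec set" where
  "lq_ball n q \<rho> = {v \<in> carrier_vec n. (\<forall>i<n. 0 \<le> v $ i) \<and> lq_norm q v \<le> \<rho>}"

definition schatten_ball :: "nat \<Rightarrow> nat \<Rightarrow> ereal \<Rightarrow> real \<Rightarrow> complex mat set" where
  "schatten_ball n1 n2 q \<rho> = {X \<in> carrier_mat n1 n2. schatten_norm q X \<le> \<rho>}"

definition vec_proj :: "real vec set \<Rightarrow> real vec \<Rightarrow> real vec" where
  "vec_proj B w = arg_min_on (\<lambda>v. (euclidean_norm (v - w))\<^sup>2) B"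

definition mat_proj :: "complex mat set \<Rightarrow> complex mat \<Rightarrow> complex mat" where
  "mat_proj B Y = arg_min_on (\<lambda>X. (frobenius_norm (X - Y))\<^sup>2) B"

end

theory Submission
  imports Defs "HOL-Analysis.Function_Topology" "HOL-Analysis.Convex"
begin

text \<open>If \<open>X\<close> has singular values \<open>d\<close> and \<open>Z = U\<^sup>H X V\<close>, then the moduli of the diagonal entries of \<open>Z\<close>
  are bounded by \<open>W d\<close>, where the weights \<open>\<bar>A(k,j)\<bar> \<bar>B(k,j)\<bar>\<close> of two unitary matrices form a doubly
  substochastic matrix \<open>W\<close>; by convexity of \<open>t \<mapsto> t\<^sup>q\<close> such a \<open>W\<close> does not increase the \<open>\<ell>\<^sub>q\<close> norm.
  Applied to two decompositions of the same matrix this also shows that the Schatten norm does not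
  depend on the chosen decomposition. Hence the diagonal of \<open>Z\<close> gives a point of the vector ball, and
  the variational inequality for the vector projection \<open>p\<close> of \<open>\<sigma>(Y)\<close>, summed along the
  diagonal, yields \<open>\<parallel>X - Y\<parallel>\<^sup>2 \<ge> \<parallel>X\<^sub>0 - Y\<parallel>\<^sup>2 + \<parallel>X - X\<^sub>0\<parallel>\<^sup>2\<close> for \<open>X\<^sub>0 = U diag(p) V\<^sup>H\<close>, which is
  minimality and uniqueness at once.\<close>

unbundle no inner_syntax

subsection \<open>Convexity and projection for the vector ball\<close>

text \<open>Bernoulli's inequality with a real exponent. It is Young's inequality for the product
  \<open>y * 1\<close> with the conjugate exponents \<open>p\<close> and \<open>p / (p - 1)\<close>;
  the case \<open>p = 1\<close>, where the second exponent degenerates, is an equality.\<close>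

lemma powr_ge_tangent_at_1:
  fixes p y :: real
  assumes "1 \<le> p" "0 \<le> y"
  shows "1 + p * (y - 1) \<le> y powr p"
proof (cases "p = 1")
  case True
  then show ?thesis using assms by simp
next
  case False
  then have p: "1 < p" using assms by simp
  have "y * 1 \<le> y powr p / p + 1 powr (p / (p - 1)) / (p / (p - 1))"
    by (rule Youngs_inequality) (use p assms in \<open>auto simp: field_simps\<close>)
  then have "y \<le> (y powr p + (p - 1)) / p"
    using p by (simp add: add_divide_distrib)
  then show ?thesis
    using p by (simp add: field_simps)
qed

text \<open>By homogeneity the tangent at \<open>a\<close> comes from the tangent at 1, taken at
  \<open>y / a\<close> and multiplied by \<open>a powr p\<close>.\<close>

lemma powr_ge_tangent:
  fixes p a y :: real
  assumes "1 \<le> p" "0 < a" "0 \<le> y"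
  shows "a powr p + p * a powr (p - 1) * (y - a) \<le> y powr p"
proof -
  have "a powr p * (1 + p * (y / a - 1)) \<le> a powr p * (y / a) powr p"
    using powr_ge_tangent_at_1[of p "y / a"] assms by (intro mult_left_mono) auto
  also have "\<dots> = y powr p"
    using assms by (simp add: powr_mult[symmetric])
  finally have le: "a powr p * (1 + p * (y / a - 1)) \<le> y powr p" .
  have pa: "a powr p = a * a powr (p - 1)"
    using assms by (simp add: powr_diff)
  have "a powr p * (1 + p * (y / a - 1)) = a powr p + p * a powr (p - 1) * (a * (y / a) - a)"
    unfolding pa by (simp only: algebra_simps)
  also have "a * (y / a) = y"
    using assms by simp
  finally show ?thesis
    using le by simp
qed

text \<open>Jensen's inequality for weights of total mass \<open>W\<close> at most 1. The tangent at
  the weighted sum \<open>a\<close>, summed against the weights, equals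
  \<open>a powr p * (1 + (p - 1) * (1 - W))\<close>, so the missing mass only helps.\<close>

lemma powr_sum_le_sum_powr:
  fixes w x :: "'a \<Rightarrow> real"
  assumes p: "1 \<le> p" and w: "\<And>j. j \<in> J \<Longrightarrow> 0 \<le> w j" and W: "sum w J \<le> 1"
    and x: "\<And>j. j \<in> J \<Longrightarrow> 0 \<le> x j"
  shows "(\<Sum>j\<in>J. w j * x j) powr p \<le> (\<Sum>j\<in>J. w j * x j powr p)"
proof -
  define a where "a = (\<Sum>j\<in>J. w j * x j)"
  have a0: "0 \<le> a"
    unfolding a_def using w x by (intro sum_nonneg) auto
  show ?thesis
  \<comment> \<open>The tangent is available at positive points only; for \<open>a = 0\<close> the
    left side is \<open>0 powr p = 0\<close>.\<close>
  proof (cases "a = 0")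
    case True
    then show ?thesis
      using w by (auto simp: a_def[symmetric] intro!: sum_nonneg)
  next
    case False
    then have a: "0 < a" using a0 by simp
    have pa: "a powr p = a * a powr (p - 1)"
      using a by (simp add: powr_diff)
    have "0 \<le> (p - 1) * (1 - sum w J) * a powr p"
      using p W by (intro mult_nonneg_nonneg) auto
    then have "a powr p \<le> sum w J * a powr p + p * a powr (p - 1) * (a - sum w J * a)"
      by (simp add: pa algebra_simps)
    also have "\<dots> = (\<Sum>j\<in>J. w j * (a powr p + p * a powr (p - 1) * (x j - a)))"
    proof -
      have "(\<Sum>j\<in>J. w j * (c + e * (x j - a))) = sum w J * c + e * (a - sum w J * a)" for c e
      proof -
        have "(\<Sum>j\<in>J. w j * (c + e * (x j - a))) =
          (\<Sum>j\<in>J. w j * c + (e * (w j * x j) - e * (w j * a)))"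
          by (intro sum.cong) (auto simp: algebra_simps)
        also have "\<dots> = sum w J * c + (e * a - e * (sum w J * a))"
          unfolding sum.distrib sum_subtractf sum_distrib_left[symmetric]
            sum_distrib_right[symmetric] a_def ..
        finally show ?thesis by (simp add: algebra_simps)
      qed
      then show ?thesis by simp
    qed
    also have "\<dots> \<le> (\<Sum>j\<in>J. w j * x j powr p)"
      using powr_ge_tangent[OF p a] w x by (intro sum_mono mult_left_mono) auto
    finally show ?thesis by (simp add: a_def)
  qed
qed

lemma powr_le_powr_iff:
  fixes a b p :: real
  assumes "0 < p" "0 \<le> a" "0 \<le> b"
  shows "a powr p \<le> b powr p \<longleftrightarrow> a \<le> b"
  using assms powr_less_mono2[of p b a] powr_mono2[of p a b] by force

section \<open>The \<open>lq_norm\<close> and substochastic weights\<close>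

text \<open>Nonnegativity of \<open>\<rho>\<close> accounts for the 0 inserted into the
  maximum.\<close>

lemma lq_norm_infinity_le_iff:
  assumes "0 \<le> \<rho>"
  shows "lq_norm \<infinity> v \<le> \<rho> \<longleftrightarrow> (\<forall>i<dim_vec v. \<bar>v $ i\<bar> \<le> \<rho>)"
  using assms by (auto simp: lq_norm_def)

text \<open>Removing the outer root turns membership in a ball into a bound on a sum of powers, to
  which convexity and continuity of the single terms apply.\<close>

lemma lq_norm_finite_le_iff:
  assumes "1 \<le> q" "q \<noteq> \<infinity>" "0 \<le> \<rho>"
  shows "lq_norm q v \<le> \<rho> \<longleftrightarrow>
    (\<Sum>i<dim_vec v. \<bar>v $ i\<bar> powr real_of_ereal q) \<le> \<rho> powr real_of_ereal q"
proof -
  define p where "p = real_of_ereal q"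
  define s where "s = (\<Sum>i<dim_vec v. \<bar>v $ i\<bar> powr p)"
  have p: "0 < p"
    using assms(1,2) unfolding p_def by (cases q) auto
  have s: "0 \<le> s"
    unfolding s_def by (intro sum_nonneg) auto
  have "s powr (1 / p) \<le> \<rho> \<longleftrightarrow> (s powr (1 / p)) powr p \<le> \<rho> powr p"
    using p assms(3) by (simp add: powr_le_powr_iff)
  also have "(s powr (1 / p)) powr p = s"
    using p s by (simp add: powr_powr)
  finally show ?thesis
    using assms(2) by (simp add: lq_norm_def p_def s_def)
qed

lemma lq_norm_nonneg: "0 \<le> lq_norm q v"
  by (auto simp: lq_norm_def)

text \<open>For \<open>q = \<infinity>\<close> the row sums bound every entry by the maximum of
  \<open>d\<close>. For finite \<open>q\<close>, Jensen's inequality is applied in each row; after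
  exchanging the order of summation the column sums appear as factors that are at most 1.\<close>

lemma lq_norm_le_substochastic:
  assumes q: "1 \<le> q" and x: "dim_vec x = m" and d: "dim_vec d = m"
    and w: "\<And>i j. i < m \<Longrightarrow> j < m \<Longrightarrow> 0 \<le> w i j"
    and rows: "\<And>i. i < m \<Longrightarrow> (\<Sum>j<m. w i j) \<le> 1"
    and cols: "\<And>j. j < m \<Longrightarrow> (\<Sum>i<m. w i j) \<le> 1"
    and le: "\<And>i. i < m \<Longrightarrow> \<bar>x $ i\<bar> \<le> (\<Sum>j<m. w i j * \<bar>d $ j\<bar>)"
  shows "lq_norm q x \<le> lq_norm q d"
proof (cases "q = \<infinity>")
  case True
  \<comment> \<open>With the norm of \<open>d\<close> as radius, the claim says that
    \<open>x\<close> satisfies the membership criterion which \<open>d\<close> satisfies with this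
    radius.\<close>
  define \<rho> where "\<rho> = lq_norm \<infinity> d"
  have \<rho>: "0 \<le> \<rho>" unfolding \<rho>_def by (rule lq_norm_nonneg)
  then have dle: "\<bar>d $ j\<bar> \<le> \<rho>" if "j < m" for j
    using lq_norm_infinity_le_iff[of \<rho> d] that d by (simp add: \<rho>_def)
  have "\<bar>x $ i\<bar> \<le> \<rho>" if i: "i < m" for i
  proof -
    note le[OF i]
    also have "(\<Sum>j<m. w i j * \<bar>d $ j\<bar>) \<le> (\<Sum>j<m. w i j * \<rho>)"
      using w i dle by (intro sum_mono mult_left_mono) auto
    also have "\<dots> \<le> 1 * \<rho>"
      unfolding sum_distrib_right[symmetric] using rows[OF i] \<rho> by (intro mult_right_mono)
    finally show ?thesis by simp
  qed
  then show ?thesis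
    using lq_norm_infinity_le_iff[OF \<rho>, of x] x True by (simp add: \<rho>_def)
next
  case False
  define p where "p = real_of_ereal q"
  have p: "1 \<le> p"
    using q False unfolding p_def by (cases q) auto
  define \<rho> where "\<rho> = lq_norm q d"
  have \<rho>: "0 \<le> \<rho>" unfolding \<rho>_def by (rule lq_norm_nonneg)
  have "(\<Sum>i<m. \<bar>x $ i\<bar> powr p) \<le> (\<Sum>i<m. (\<Sum>j<m. w i j * \<bar>d $ j\<bar>) powr p)"
    using le p by (intro sum_mono powr_mono2) auto
  also have "\<dots> \<le> (\<Sum>i<m. \<Sum>j<m. w i j * \<bar>d $ j\<bar> powr p)"
    using p w rows by (intro sum_mono powr_sum_le_sum_powr) auto
  also have "\<dots> = (\<Sum>j<m. (\<Sum>i<m. w i j) * \<bar>d $ j\<bar> powr p)"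
    by (subst sum.swap) (simp add: sum_distrib_right)
  also have "\<dots> \<le> (\<Sum>j<m. 1 * \<bar>d $ j\<bar> powr p)"
    using cols by (intro sum_mono mult_right_mono) auto
  also have "\<dots> \<le> \<rho> powr p"
    using lq_norm_finite_le_iff[OF q False \<rho>, of d] d by (simp add: \<rho>_def p_def)
  finally show ?thesis
    using lq_norm_finite_le_iff[OF q False \<rho>, of x] x by (simp add: \<rho>_def p_def)
qed

text \<open>The identity matrix serves as the weights.\<close>

lemma lq_norm_mono:
  assumes "1 \<le> q" "dim_vec x = dim_vec d" "\<And>i. i < dim_vec d \<Longrightarrow> \<bar>x $ i\<bar> \<le> \<bar>d $ i\<bar>"
  shows "lq_norm q x \<le> lq_norm q d"
  by (rule lq_norm_le_substochastic[where w = "\<lambda>i j. if i = j then 1 else 0" and m = "dim_vec d"])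
    (use assms in \<open>auto simp: if_distrib[of "\<lambda>z. z * _"] cong: if_cong\<close>)

section \<open>Convexity of the vector ball and its closest points\<close>

lemma lq_ball_convex:
  assumes q: "1 \<le> q" and \<rho>: "0 \<le> \<rho>" and t: "0 \<le> t" "t \<le> 1"
    and x: "x \<in> lq_ball m q \<rho>" and y: "y \<in> lq_ball m q \<rho>"
  shows "vec m (\<lambda>i. (1 - t) * x $ i + t * y $ i) \<in> lq_ball m q \<rho>" (is "?z \<in> _")
proof -
  have dims: "dim_vec x = m" "dim_vec y = m"
    using x y by (auto simp: lq_ball_def)
  have x0: "0 \<le> x $ i" and y0: "0 \<le> y $ i" if "i < m" for i
    using x y that by (auto simp: lq_ball_def)
  have z0: "0 \<le> ?z $ i" if "i < m" for i
    using x0 y0 t that by simp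
  have "lq_norm q ?z \<le> \<rho>"
  proof (cases "q = \<infinity>")
    case True
    have "x $ i \<le> \<rho>" "y $ i \<le> \<rho>" if "i < m" for i
      using x y that \<rho> True by (auto simp: lq_ball_def lq_norm_infinity_le_iff abs_le_iff)
    then have "(1 - t) * x $ i + t * y $ i \<le> \<rho>" if "i < m" for i
      using t that by (intro convex_bound_le) auto
    then show ?thesis
      using z0 \<rho> True by (simp add: lq_norm_infinity_le_iff)
  next
    case False
    define p where "p = real_of_ereal q"
    have p: "1 \<le> p"
      using q False unfolding p_def by (cases q) auto
    \<comment> \<open>Jensen's inequality for two points, with \<open>bool\<close> as index set and
      the weights \<open>1 - t\<close> and \<open>t\<close>.\<close>
    have le: "((1 - t) * x $ i + t * y $ i) powr p \<le> (1 - t) * x $ i powr p + t * y $ i powr p"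
      if "i < m" for i
      using powr_sum_le_sum_powr[OF p, of UNIV "\<lambda>b. if b then t else 1 - t"
          "\<lambda>b. if b then y $ i else x $ i"] x0 y0 t that
      by (simp add: UNIV_bool)
    have "(\<Sum>i<m. \<bar>?z $ i\<bar> powr p) = (\<Sum>i<m. ((1 - t) * x $ i + t * y $ i) powr p)"
      using z0 by (intro sum.cong) auto
    also have "\<dots> \<le> (\<Sum>i<m. (1 - t) * x $ i powr p + t * y $ i powr p)"
      using le by (intro sum_mono) auto
    also have "\<dots> = (1 - t) * (\<Sum>i<m. x $ i powr p) + t * (\<Sum>i<m. y $ i powr p)"
      by (simp only: sum.distrib sum_distrib_left)
    also have "\<dots> = (1 - t) * (\<Sum>i<m. \<bar>x $ i\<bar> powr p) + t * (\<Sum>i<m. \<bar>y $ i\<bar> powr p)"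
      using x0 y0 by simp
    also have "\<dots> \<le> \<rho> powr p"
      using x y t \<rho> q False
      by (intro convex_bound_le) (auto simp: lq_ball_def lq_norm_finite_le_iff p_def)
    finally show ?thesis
      using q \<rho> False by (simp add: lq_norm_finite_le_iff p_def)
  qed
  then show ?thesis
    using z0 by (simp add: lq_ball_def)
qed

lemma euclidean_norm_diff_sq:
  assumes "dim_vec v = m" "dim_vec w = m"
  shows "(euclidean_norm (v - w))\<^sup>2 = (\<Sum>i<m. (v $ i - w $ i)\<^sup>2)"
  using assms by (simp add: euclidean_norm_def sum_nonneg)

text \<open>The squared distance is continuous and the ball is compact. Compactness is obtained for
  functions \<open>nat \<Rightarrow> real\<close> in the product topology, where Tychonoff's theorem
  applies, and the minimiser is then carried over to vectors.\<close>

lemma lq_ball_closest_exists: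
  assumes q: "1 \<le> q" and \<rho>: "0 \<le> \<rho>" and s: "dim_vec s = m"
  obtains p where "is_arg_min (\<lambda>v. (euclidean_norm (v - s))\<^sup>2) (\<lambda>v. v \<in> lq_ball m q \<rho>) p"
proof -
  define P where "P = real_of_ereal q"
  \<comment> \<open>Coordinates from \<open>m\<close> on are pinned to 0, so that every factor of
    the product is compact.\<close>
  define box where "box = Pi\<^sub>E UNIV (\<lambda>i. if i < m then {0..\<rho>} else {0::real})"
  \<comment> \<open>For \<open>q = \<infinity>\<close> the box alone describes the ball, hence the
    guard.\<close>
  define C where "C = {x. q \<noteq> \<infinity> \<longrightarrow> (\<Sum>i<m. \<bar>x i\<bar> powr P) \<le> \<rho> powr P}"
  have compactin_box: "compactin (product_topology (\<lambda>_. euclidean) UNIV) box"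
    unfolding box_def compactin_PiE by auto
  then have "compact box"
    by (simp add: euclidean_product_topology)
  moreover have "closed C"
  proof (cases "q = \<infinity>")
    case False
    then have P: "0 < P"
      using q unfolding P_def by (cases q) auto
    have "continuous_on UNIV (\<lambda>x::nat \<Rightarrow> real. \<Sum>i<m. \<bar>x i\<bar> powr P)"
      using P by (intro continuous_intros continuous_on_powr') auto
    then show ?thesis
      using False by (simp add: C_def closed_Collect_le)
  qed (simp add: C_def)
  ultimately have "compact (box \<inter> C)"
    by (rule compact_Int_closed)
  moreover have "(\<lambda>_. 0) \<in> box \<inter> C"
    using \<rho> by (auto simp: box_def C_def)
  moreover have "continuous_on (box \<inter> C) (\<lambda>x. \<Sum>i<m. (x i - s $ i)\<^sup>2)"
    by (rule continuous_on_subset[of UNIV]) (auto intro!: continuous_intros)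
  ultimately have "\<exists>x\<in>box \<inter> C. \<forall>y\<in>box \<inter> C. (\<Sum>i<m. (x i - s $ i)\<^sup>2) \<le> (\<Sum>i<m. (y i - s $ i)\<^sup>2)"
    by (intro continuous_attains_inf) auto
  then obtain x where x: "x \<in> box \<inter> C"
    and min: "\<And>y. y \<in> box \<inter> C \<Longrightarrow> (\<Sum>i<m. (x i - s $ i)\<^sup>2) \<le> (\<Sum>i<m. (y i - s $ i)\<^sup>2)"
    by blast
  have xb: "0 \<le> x i" "x i \<le> \<rho>" if "i < m" for i
    using x that by (auto simp: box_def PiE_iff split: if_splits)
  have "vec m x \<in> lq_ball m q \<rho>"
    using x xb q \<rho> by (cases "q = \<infinity>")
      (auto simp: lq_ball_def lq_norm_infinity_le_iff lq_norm_finite_le_iff C_def P_def)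
  moreover have "(euclidean_norm (vec m x - s))\<^sup>2 \<le> (euclidean_norm (v - s))\<^sup>2"
    if v: "v \<in> lq_ball m q \<rho>" for v
  proof -
    define y where "y i = (if i < m then v $ i else 0)" for i
    have dv: "dim_vec v = m" and v0: "\<And>i. i < m \<Longrightarrow> 0 \<le> v $ i"
      using v by (auto simp: lq_ball_def)
    have "v $ i \<le> \<rho>" if i: "i < m" for i
    proof -
      \<comment> \<open>The ball lies in the box: a single power is at most the sum of all powers,
        so every entry is at most \<open>\<rho>\<close>.\<close>
      have "lq_norm \<infinity> v \<le> \<rho>"
      proof (cases "q = \<infinity>")
        case False
        then have P: "0 < P"
          using q unfolding P_def by (cases q) auto
        have "v $ j \<le> \<rho>" if j: "j < m" for j
        proof -
          have "v $ j powr P = \<bar>v $ j\<bar> powr P"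
            using v0[OF j] by simp
          also have "\<dots> \<le> (\<Sum>i<m. \<bar>v $ i\<bar> powr P)"
            using j by (intro member_le_sum) auto
          also have "\<dots> \<le> \<rho> powr P"
            using v lq_norm_finite_le_iff[OF q False \<rho>, of v] unfolding lq_ball_def dv P_def by blast
          finally show ?thesis
            using P v0[OF j] \<rho> by (simp add: powr_le_powr_iff)
        qed
        then show ?thesis
          using v0 dv \<rho> by (simp add: lq_norm_infinity_le_iff)
      qed (use v in \<open>simp add: lq_ball_def\<close>)
      then show ?thesis
        using i dv \<rho> by (auto simp: lq_norm_infinity_le_iff abs_le_iff)
    qed
    then have "y \<in> box"
      using v0 by (auto simp: box_def y_def)
    moreover have "(\<Sum>i<m. \<bar>y i\<bar> powr P) \<le> \<rho> powr P" if "q \<noteq> \<infinity>"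
    proof -
      have "(\<Sum>i<m. \<bar>y i\<bar> powr P) = (\<Sum>i<dim_vec v. \<bar>v $ i\<bar> powr P)"
        unfolding dv by (intro sum.cong) (auto simp: y_def)
      then show ?thesis
        using v lq_norm_finite_le_iff[OF q that \<rho>, of v] by (simp add: lq_ball_def P_def)
    qed
    then have "y \<in> C" by (simp add: C_def)
    ultimately have "(\<Sum>i<m. (x i - s $ i)\<^sup>2) \<le> (\<Sum>i<m. (y i - s $ i)\<^sup>2)"
      using min by blast
    then show ?thesis
      using s dv by (simp add: euclidean_norm_diff_sq[of _ m] y_def)
  qed
  ultimately show thesis
    using that[of "vec m x"] by (auto simp: is_arg_min_linorder)
qed

text \<open>The obtuse-angle criterion for convex sets. A step of length \<open>t\<close> from
  \<open>p\<close> towards \<open>v\<close> stays in the ball and changes the squared distance to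
  \<open>s\<close> by \<open>- 2 * t * c + t\<^sup>2 * N\<close>, which would be negative for small
  \<open>t\<close> if \<open>c\<close> were positive.\<close>

lemma lq_ball_closest_variational:
  assumes q: "1 \<le> q" and \<rho>: "0 \<le> \<rho>" and s: "dim_vec s = m"
    and p: "is_arg_min (\<lambda>v. (euclidean_norm (v - s))\<^sup>2) (\<lambda>v. v \<in> lq_ball m q \<rho>) p"
    and v: "v \<in> lq_ball m q \<rho>"
  shows "(\<Sum>i<m. (v $ i - p $ i) * (s $ i - p $ i)) \<le> 0"
proof (rule ccontr)
  define c where "c = (\<Sum>i<m. (v $ i - p $ i) * (s $ i - p $ i))"
  define N where "N = (\<Sum>i<m. (v $ i - p $ i)\<^sup>2)"
  assume "\<not> ?thesis"
  then have c: "0 < c" by (simp add: c_def)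
  have N: "0 \<le> N" unfolding N_def by (intro sum_nonneg) auto
  \<comment> \<open>The minimum keeps the point on the segment, the quotient forces
    \<open>t * N \<le> c\<close>, and \<open>N + 1\<close> stays positive even when \<open>v\<close>
    and \<open>p\<close> agree.\<close>
  define t where "t = min 1 (c / (N + 1))"
  have t: "0 < t" "t \<le> 1" using c N by (auto simp: t_def)
  have pB: "p \<in> lq_ball m q \<rho>" and pd: "dim_vec p = m"
    using p by (auto simp: is_arg_min_linorder lq_ball_def)
  define z where "z = vec m (\<lambda>i. (1 - t) * p $ i + t * v $ i)"
  have "z \<in> lq_ball m q \<rho>"
    unfolding z_def using q \<rho> t pB v by (intro lq_ball_convex) auto
  then have "(\<Sum>i<m. (p $ i - s $ i)\<^sup>2) \<le> (\<Sum>i<m. (z $ i - s $ i)\<^sup>2)"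
    using p s pd euclidean_norm_diff_sq[of z m s] euclidean_norm_diff_sq[of p m s]
    by (auto simp: is_arg_min_linorder z_def simp del: index_vec)
  also have "\<dots> = (\<Sum>i<m. (p $ i - s $ i)\<^sup>2 - 2 * t * ((v $ i - p $ i) * (s $ i - p $ i))
      + t\<^sup>2 * (v $ i - p $ i)\<^sup>2)"
    by (intro sum.cong) (auto simp: z_def power2_eq_square algebra_simps)
  also have "\<dots> = (\<Sum>i<m. (p $ i - s $ i)\<^sup>2) - 2 * t * c + t\<^sup>2 * N"
    by (simp add: c_def N_def sum.distrib sum_subtractf sum_distrib_left)
  finally have "t * (2 * c) \<le> t * (t * N)"
    by (simp add: power2_eq_square algebra_simps)
  then have "2 * c \<le> t * N" using t by simp
  also have "\<dots> \<le> c / (N + 1) * (N + 1)"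
    using N t c by (intro mult_mono) (auto simp: t_def)
  also have "\<dots> = c" using N by simp
  finally show False using c by simp
qed

text \<open>Lowering the entry \<open>k\<close> of \<open>p\<close> to \<open>s $ k\<close> would
  stay in the ball by monotonicity of the norm, and the variational inequality for this point reads
  \<open>(s $ k - p $ k)\<^sup>2 \<le> 0\<close>. This fixes the sign of \<open>s - p\<close> when
  moduli replace real parts on the diagonal of a matrix.\<close>

lemma lq_ball_closest_le:
  assumes q: "1 \<le> q" and \<rho>: "0 \<le> \<rho>" and s: "dim_vec s = m"
    and p: "is_arg_min (\<lambda>v. (euclidean_norm (v - s))\<^sup>2) (\<lambda>v. v \<in> lq_ball m q \<rho>) p"
    and k: "k < m" "0 \<le> s $ k"
  shows "p $ k \<le> s $ k"
proof (rule ccontr)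
  assume "\<not> ?thesis"
  then have gt: "s $ k < p $ k" by simp
  define v where "v = vec m (\<lambda>i. if i = k then s $ k else p $ i)"
  have pB: "p \<in> lq_ball m q \<rho>" and pd: "dim_vec p = m" and p0: "\<And>i. i < m \<Longrightarrow> 0 \<le> p $ i"
    using p by (auto simp: is_arg_min_linorder lq_ball_def)
  have "lq_norm q v \<le> lq_norm q p"
    using q k gt p0 pd by (intro lq_norm_mono) (auto simp: v_def)
  then have "v \<in> lq_ball m q \<rho>"
    using pB k p0 by (auto simp: lq_ball_def v_def)
  from lq_ball_closest_variational[OF q \<rho> s p this]
  have "(\<Sum>i<m. (v $ i - p $ i) * (s $ i - p $ i)) \<le> 0" .
  also have "(\<Sum>i<m. (v $ i - p $ i) * (s $ i - p $ i)) = (\<Sum>i<m. if i = k then (s $ k - p $ k)\<^sup>2 else 0)"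
    by (intro sum.cong) (auto simp: v_def power2_eq_square)
  finally show False using gt k by simp
qed

subsection \<open>Unitary matrices and the singular value decomposition\<close>

lemma dim_mat_adjoint [simp]:
  "dim_row (mat_adjoint A) = dim_col A" "dim_col (mat_adjoint A) = dim_row A"
  by (simp_all add: mat_adjoint_def)

lemma mat_adjoint_carrier [simp]: "A \<in> carrier_mat n m \<Longrightarrow> mat_adjoint A \<in> carrier_mat m n"
  by (rule carrier_matI) auto

lemma index_mat_adjoint [simp]:
  "i < dim_col A \<Longrightarrow> j < dim_row A \<Longrightarrow> mat_adjoint A $$ (i, j) = conjugate (A $$ (j, i))"
  by (simp add: mat_adjoint_def mat_of_rows_def)

lemma mat_adjoint_mat_adjoint [simp]: "mat_adjoint (mat_adjoint A) = A"
  by (rule eq_matI) auto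

lemma mat_adjoint_one [simp]: "mat_adjoint (1\<^sub>m n :: complex mat) = 1\<^sub>m n"
  by (rule eq_matI) auto

lemma mat_adjoint_mult:
  fixes A B :: "complex mat"
  assumes "dim_col A = dim_row B"
  shows "mat_adjoint (A * B) = mat_adjoint B * mat_adjoint A"
  by (rule eq_matI) (use assms in \<open>auto simp: scalar_prod_def mult.commute\<close>)

lemma mat_mult_assoc_dim:
  assumes "dim_col A = dim_row B" "dim_col B = dim_row C"
  shows "A * B * C = A * (B * C)"
  by (rule assoc_mult_mat[of _ "dim_row A" "dim_col A" _ "dim_col B" _ "dim_col C"])
    (use assms in \<open>auto intro: carrier_matI\<close>)

lemma mat_adjoint_four_block_diag:
  fixes A D :: "complex mat"
  assumes "A \<in> carrier_mat n1 m1" "D \<in> carrier_mat n2 m2"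
  shows "mat_adjoint (four_block_mat A (0\<^sub>m n1 m2) (0\<^sub>m n2 m1) D) =
    four_block_mat (mat_adjoint A) (0\<^sub>m m1 n2) (0\<^sub>m m2 n1) (mat_adjoint D)"
  by (rule eq_matI) (use assms in auto)

lemma mult_four_block_diag:
  fixes A1 D1 :: "'a::semiring_1 mat"
  assumes "A1 \<in> carrier_mat n1 m1" "D1 \<in> carrier_mat n2 m2"
    and "A2 \<in> carrier_mat m1 k1" "D2 \<in> carrier_mat m2 k2"
  shows "four_block_mat A1 (0\<^sub>m n1 m2) (0\<^sub>m n2 m1) D1 * four_block_mat A2 (0\<^sub>m m1 k2) (0\<^sub>m m2 k1) D2 =
    four_block_mat (A1 * A2) (0\<^sub>m n1 k2) (0\<^sub>m n2 k1) (D1 * D2)"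
  by (subst mult_four_block_mat[OF assms(1) _ _ assms(2,3) _ _ assms(4)]) (use assms in auto)

lemma unitary_matsD:
  assumes "U \<in> unitary_mats n"
  shows "U \<in> carrier_mat n n" "U * mat_adjoint U = 1\<^sub>m n" "mat_adjoint U * U = 1\<^sub>m n"
  using assms by (auto simp: unitary_mats_def)

lemma unitary_mats_one [simp]: "1\<^sub>m n \<in> unitary_mats n"
  by (simp add: unitary_mats_def)

lemma unitary_mats_adjoint: "U \<in> unitary_mats n \<Longrightarrow> mat_adjoint U \<in> unitary_mats n"
  by (simp add: unitary_mats_def)

lemma unitary_mats_cancel:
  assumes "U \<in> unitary_mats n" "dim_row A = n"
  shows "mat_adjoint U * (U * A) = A" "U * (mat_adjoint U * A) = A"
proof -
  note U = unitary_matsD[OF assms(1)]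
  have A: "A \<in> carrier_mat n (dim_col A)" using assms(2) by auto
  have "mat_adjoint U * (U * A) = mat_adjoint U * U * A" "U * (mat_adjoint U * A) = U * mat_adjoint U * A"
    using U(1) A by (simp_all add: mat_mult_assoc_dim)
  then show "mat_adjoint U * (U * A) = A" "U * (mat_adjoint U * A) = A"
    using U A by simp_all
qed

lemma unitary_mats_mult:
  assumes U: "U \<in> unitary_mats n" and V: "V \<in> unitary_mats n"
  shows "U * V \<in> unitary_mats n"
  using unitary_matsD[OF U] unitary_matsD[OF V]
  by (simp add: unitary_mats_def mat_adjoint_mult mat_mult_assoc_dim
      unitary_mats_cancel[OF U] unitary_mats_cancel[OF V])

lemma unitary_mats_four_block_diag:
  assumes "U \<in> unitary_mats n" "V \<in> unitary_mats m"
  shows "four_block_mat U (0\<^sub>m n m) (0\<^sub>m m n) V \<in> unitary_mats (n + m)"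
  using unitary_matsD[OF assms(1)] unitary_matsD[OF assms(2)]
  by (simp add: unitary_mats_def mat_adjoint_four_block_diag[of U n n V m m]
      mult_four_block_diag[of _ n n _ m m _ n _ m] four_block_one_mat)

text \<open>This is the diagonal entry \<open>(i, i)\<close> of
  \<open>U * mat_adjoint U = 1\<^sub>m n\<close>.\<close>

lemma unitary_mats_row_sum:
  assumes "U \<in> unitary_mats n" "i < n"
  shows "(\<Sum>j<n. (cmod (U $$ (i, j)))\<^sup>2) = 1"
proof -
  note U = unitary_matsD[OF assms(1)]
  have "complex_of_real (\<Sum>j<n. (cmod (U $$ (i, j)))\<^sup>2) = (U * mat_adjoint U) $$ (i, i)"
    using U(1) assms(2)
    by (simp add: scalar_prod_def complex_norm_square atLeast0LessThan del: of_real_power)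
  also have "\<dots> = 1" using U(2) assms(2) by simp
  finally show ?thesis using of_real_eq_1_iff by blast
qed

text \<open>By \<open>a * b \<le> a\<^sup>2 / 2 + b\<^sup>2 / 2\<close> the sum is at most the mean
  of two squared row norms, each equal to 1 before truncation to \<open>m\<close> columns. Applied
  to the adjoints, it bounds the column sums of the same weights.\<close>

lemma unitary_mats_weight_le:
  assumes A: "A \<in> unitary_mats n1" and B: "B \<in> unitary_mats n2"
    and m: "m \<le> n1" "m \<le> n2" "k < m"
  shows "(\<Sum>j<m. cmod (A $$ (k, j)) * cmod (B $$ (k, j))) \<le> 1"
proof -
  have "(\<Sum>j<m. cmod (A $$ (k, j)) * cmod (B $$ (k, j))) \<le>
      (\<Sum>j<m. (cmod (A $$ (k, j)))\<^sup>2 / 2 + (cmod (B $$ (k, j)))\<^sup>2 / 2)"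
  proof (rule sum_mono)
    show "cmod (A $$ (k, j)) * cmod (B $$ (k, j)) \<le> (cmod (A $$ (k, j)))\<^sup>2 / 2 + (cmod (B $$ (k, j)))\<^sup>2 / 2" for j
      using sum_squares_bound[of "cmod (A $$ (k, j))" "cmod (B $$ (k, j))"] by simp
  qed
  also have "\<dots> = (\<Sum>j<m. (cmod (A $$ (k, j)))\<^sup>2) / 2 + (\<Sum>j<m. (cmod (B $$ (k, j)))\<^sup>2) / 2"
    by (simp add: sum.distrib sum_divide_distrib)
  also have "\<dots> \<le> (\<Sum>j<n1. (cmod (A $$ (k, j)))\<^sup>2) / 2 + (\<Sum>j<n2. (cmod (B $$ (k, j)))\<^sup>2) / 2"
    using m by (intro add_mono divide_right_mono sum_mono2) auto
  also have "\<dots> = 1"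
    using unitary_mats_row_sum[OF A, of k] unitary_mats_row_sum[OF B, of k] m by simp
  finally show ?thesis .
qed

section \<open>Unitary invariance of the Frobenius norm\<close>

lemma frobenius_norm_sq:
  assumes "A \<in> carrier_mat n m"
  shows "(frobenius_norm A)\<^sup>2 = (\<Sum>i<n. \<Sum>j<m. (cmod (A $$ (i, j)))\<^sup>2)"
  using assms by (simp add: frobenius_norm_def sum_nonneg)

text \<open>In the trace form a unitary left factor of \<open>A\<close> cancels inside
  \<open>mat_adjoint A * A\<close>; the form also links the norm of \<open>A\<close> to the
  eigenvalues of that product.\<close>

lemma frobenius_norm_sq_eq_trace:
  assumes "A \<in> carrier_mat n m"
  shows "complex_of_real ((frobenius_norm A)\<^sup>2) = (\<Sum>j<m. (mat_adjoint A * A) $$ (j, j))"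
  using assms
  by (subst frobenius_norm_sq[OF assms], subst sum.swap)
    (simp add: scalar_prod_def complex_norm_square atLeast0LessThan mult.commute del: of_real_power)

lemma frobenius_norm_adjoint:
  "(frobenius_norm (mat_adjoint A))\<^sup>2 = (frobenius_norm A)\<^sup>2"
  by (subst frobenius_norm_sq[of A "dim_row A" "dim_col A"], simp,
      subst frobenius_norm_sq[of "mat_adjoint A" "dim_col A" "dim_row A"], simp,
      subst sum.swap) simp

lemma frobenius_norm_unitary_left:
  assumes U: "U \<in> unitary_mats n" and A: "A \<in> carrier_mat n m"
  shows "(frobenius_norm (U * A))\<^sup>2 = (frobenius_norm A)\<^sup>2"
proof -
  note U = unitary_matsD[OF U]
  have "mat_adjoint (U * A) * (U * A) = mat_adjoint A * A"
    using U(1) A unitary_mats_cancel[OF assms(1)] by (simp add: mat_adjoint_mult mat_mult_assoc_dim)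
  then have "complex_of_real ((frobenius_norm (U * A))\<^sup>2) = complex_of_real ((frobenius_norm A)\<^sup>2)"
    using U(1) A by (simp only: frobenius_norm_sq_eq_trace[of _ n m] mult_carrier_mat)
  then show ?thesis by (simp only: of_real_eq_iff)
qed

text \<open>The right factor becomes a left factor after taking adjoints, which preserves the
  norm.\<close>

lemma frobenius_norm_unitary:
  assumes U: "U \<in> unitary_mats n" and V: "V \<in> unitary_mats m" and A: "A \<in> carrier_mat n m"
  shows "(frobenius_norm (U * A * V))\<^sup>2 = (frobenius_norm A)\<^sup>2"
proof -
  note Uc = unitary_matsD(1)[OF U] and Vc = unitary_matsD(1)[OF V]
  have "(frobenius_norm (U * A * V))\<^sup>2 = (frobenius_norm (mat_adjoint V * mat_adjoint (U * A)))\<^sup>2"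
    unfolding frobenius_norm_adjoint[of "U * A * V", symmetric]
    using Uc Vc A by (subst mat_adjoint_mult) auto
  also have "\<dots> = (frobenius_norm (U * A))\<^sup>2"
    using Uc A frobenius_norm_unitary_left[OF unitary_mats_adjoint[OF V], of "mat_adjoint (U * A)" n]
    by (simp add: frobenius_norm_adjoint)
  finally show ?thesis
    using frobenius_norm_unitary_left[OF U A] by simp
qed

section \<open>Traces, eigenvalues and singular pairs\<close>

lemma cscalar_prod_self:
  "v \<bullet>c v = complex_of_real (\<Sum>i<dim_vec v. (cmod (v $ i))\<^sup>2)"
  by (simp add: scalar_prod_def complex_norm_square atLeast0LessThan del: of_real_power)

lemma cscalar_prod_adjoint:
  fixes A :: "complex mat"
  assumes "A \<in> carrier_mat n m" "x \<in> carrier_vec n" "y \<in> carrier_vec m"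
  shows "(mat_adjoint A *\<^sub>v x) \<bullet>c y = x \<bullet>c (A *\<^sub>v y)"
proof -
  have "(mat_adjoint A *\<^sub>v x) \<bullet>c y = (\<Sum>j<m. \<Sum>i<n. cnj (A $$ (i, j)) * x $ i * cnj (y $ j))"
    using assms by (simp add: scalar_prod_def atLeast0LessThan sum_distrib_right)
  also have "\<dots> = (\<Sum>i<n. \<Sum>j<m. cnj (A $$ (i, j)) * x $ i * cnj (y $ j))"
    by (rule sum.swap)
  also have "\<dots> = x \<bullet>c (A *\<^sub>v y)"
    using assms by (simp add: scalar_prod_def atLeast0LessThan sum_distrib_left mult_ac)
  finally show ?thesis .
qed

lemma sum_diag_mult_commute:
  fixes A B :: "'a::comm_semiring_0 mat"
  assumes "A \<in> carrier_mat n m" "B \<in> carrier_mat m n"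
  shows "(\<Sum>i<n. (A * B) $$ (i, i)) = (\<Sum>i<m. (B * A) $$ (i, i))"
proof -
  have "(\<Sum>i<n. (A * B) $$ (i, i)) = (\<Sum>i<n. \<Sum>j<m. A $$ (i, j) * B $$ (j, i))"
    using assms by (simp add: scalar_prod_def atLeast0LessThan)
  also have "\<dots> = (\<Sum>j<m. \<Sum>i<n. A $$ (i, j) * B $$ (j, i))"
    by (rule sum.swap)
  also have "\<dots> = (\<Sum>i<m. (B * A) $$ (i, i))"
    using assms by (simp add: scalar_prod_def atLeast0LessThan mult.commute)
  finally show ?thesis .
qed

lemma sum_diag_similar:
  assumes "similar_mat A B" "A \<in> carrier_mat n n"
  shows "(\<Sum>i<n. A $$ (i, i)) = (\<Sum>i<n. B $$ (i, i :: nat) :: 'a::comm_semiring_1)"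
proof -
  obtain P Q where PQ: "similar_mat_wit A B P Q"
    using assms(1) by (auto simp: similar_mat_def)
  note w = similar_mat_witD2[OF assms(2) PQ]
  have "(\<Sum>i<n. A $$ (i, i)) = (\<Sum>i<n. (Q * (P * B)) $$ (i, i))"
    unfolding w(3) using w by (intro sum_diag_mult_commute) auto
  also have "Q * (P * B) = B"
    using w by (simp add: assoc_mult_mat[of Q n n P n B n, symmetric])
  finally show ?thesis .
qed

text \<open>Schur triangularisation preserves the trace, so some diagonal entry of the triangular
  form is nonzero, and its diagonal entries are eigenvalues.\<close>

lemma nonzero_eigenvalue_if_trace_nonzero:
  fixes A :: "complex mat"
  assumes A: "A \<in> carrier_mat n n" and tr: "(\<Sum>i<n. A $$ (i, i)) \<noteq> 0"
  obtains e where "eigenvalue A e" "e \<noteq> 0"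
proof -
  obtain es where "char_poly A = (\<Prod>a\<leftarrow>es. [:- a, 1:])"
    using char_poly_factorized[OF A] by blast
  then obtain B where B: "B \<in> carrier_mat n n" "upper_triangular B" and sim: "similar_mat A B"
    using schur_decomposition_exists[OF A] by blast
  obtain i where i: "i < n" "B $$ (i, i) \<noteq> 0"
    using tr unfolding sum_diag_similar[OF sim A] by (metis (no_types, lifting) lessThan_iff sum.neutral)
  have "char_poly A = (\<Prod>a\<leftarrow>diag_mat B. [:- a, 1:])"
    using char_poly_similar[OF sim] char_poly_upper_triangular[OF B] by simp
  moreover have "B $$ (i, i) \<in> set (diag_mat B)"
    using B(1) i(1) by (auto simp: diag_mat_def)
  ultimately have "poly (char_poly A) (B $$ (i, i)) = 0"
    by (auto simp: poly_prod_list prod_list_zero_iff)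
  then show thesis
    using that i(2) eigenvalue_root_char_poly[OF A] by blast
qed

text \<open>The trace of \<open>mat_adjoint X * X\<close> is the squared Frobenius norm of
  \<open>X\<close>, hence nonzero, and yields a nonzero eigenvalue \<open>e\<close> with a unit
  eigenvector \<open>v\<close>. Then \<open>s\<close> is the square root of \<open>e\<close>, and
  \<open>u\<close> is \<open>X *\<^sub>v v\<close> divided by \<open>s\<close>.\<close>

lemma singular_pair_exists:
  fixes X :: "complex mat"
  assumes X: "X \<in> carrier_mat n m" and nz: "X \<noteq> 0\<^sub>m n m"
  obtains s u v where "0 < (s::real)" "u \<in> carrier_vec n" "v \<in> carrier_vec m"
    "u \<bullet>c u = 1" "v \<bullet>c v = 1"
    "X *\<^sub>v v = complex_of_real s \<cdot>\<^sub>v u" "mat_adjoint X *\<^sub>v u = complex_of_real s \<cdot>\<^sub>v v"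
proof -
  define M where "M = mat_adjoint X * X"
  have M: "M \<in> carrier_mat m m" using X by (intro carrier_matI) (auto simp: M_def)
  have "\<exists>i<n. \<exists>j<m. X $$ (i, j) \<noteq> 0"
    using X nz by (metis carrier_matD eq_matI index_zero_mat)
  then obtain i j where ij: "i < n" "j < m" "X $$ (i, j) \<noteq> 0" by blast
  have "0 < (\<Sum>j<m. (cmod (X $$ (i, j)))\<^sup>2)"
    using ij by (subst sum_pos2[where i = j]) auto
  then have "0 < (frobenius_norm X)\<^sup>2"
    unfolding frobenius_norm_sq[OF X] using ij by (subst sum_pos2[where i = i]) (auto intro: sum_nonneg)
  then have "(\<Sum>i<m. M $$ (i, i)) \<noteq> 0"
    using frobenius_norm_sq_eq_trace[OF X] unfolding M_def by (metis less_irrefl of_real_eq_0_iff)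
  then obtain e where e: "eigenvalue M e" "e \<noteq> 0"
    using nonzero_eigenvalue_if_trace_nonzero[OF M] by blast
  then obtain w where w: "w \<in> carrier_vec m" "w \<noteq> 0\<^sub>v m" "M *\<^sub>v w = e \<cdot>\<^sub>v w"
    using M by (auto simp: eigenvalue_def eigenvector_def)
  define N where "N = (\<Sum>i<m. (cmod (w $ i))\<^sup>2)"
  have ww: "w \<bullet>c w = complex_of_real N"
    using w(1) by (simp add: cscalar_prod_self N_def)
  have "N \<noteq> 0"
    using ww w(2) conjugate_square_eq_0_vec[OF w(1)] by auto
  moreover have "0 \<le> N" by (simp add: N_def sum_nonneg)
  ultimately have N: "0 < N" by simp
  define r where "r = 1 / sqrt N"
  define v where "v = complex_of_real r \<cdot>\<^sub>v w"
  have v: "v \<in> carrier_vec m" using w(1) by (simp add: v_def)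
  have vv: "v \<bullet>c v = 1"
  proof -
    have "v \<bullet>c v = complex_of_real (r * r) * (w \<bullet>c w)"
      using w(1) by (simp add: v_def conjugate_smult_vec)
    also have "\<dots> = complex_of_real (r * r * N)"
      by (simp only: ww of_real_mult)
    also have "r * r * N = 1"
      using N by (simp add: r_def)
    finally show ?thesis by simp
  qed
  have Mv: "M *\<^sub>v v = e \<cdot>\<^sub>v v"
    using w M by (simp add: v_def mult_mat_vec[OF M] smult_smult_assoc mult.commute)
  define K where "K = (\<Sum>i<n. (cmod ((X *\<^sub>v v) $ i))\<^sup>2)"
  have XX: "mat_adjoint X *\<^sub>v (X *\<^sub>v v) = e \<cdot>\<^sub>v v"
  proof -
    have "M *\<^sub>v v = mat_adjoint X *\<^sub>v (X *\<^sub>v v)"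
      unfolding M_def using X v by (intro assoc_mult_mat_vec) auto
    then show ?thesis using Mv by simp
  qed
  \<comment> \<open>Pairing the eigenvalue equation with \<open>v\<close> identifies
    \<open>e\<close> with the squared length of \<open>X *\<^sub>v v\<close>, so it is real and
    positive.\<close>
  have "e = (e \<cdot>\<^sub>v v) \<bullet>c v" using v vv by simp
  also have "\<dots> = (X *\<^sub>v v) \<bullet>c (X *\<^sub>v v)"
    unfolding XX[symmetric] using X v by (intro cscalar_prod_adjoint) auto
  also have XvXv: "(X *\<^sub>v v) \<bullet>c (X *\<^sub>v v) = complex_of_real K"
    using X by (simp add: cscalar_prod_self K_def)
  finally have eK: "e = complex_of_real K" .
  have "0 \<le> K" by (simp add: K_def sum_nonneg)
  then have K: "0 < K" using e(2) eK by (cases "K = 0") auto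
  define s where "s = sqrt K"
  have s: "0 < s" "s * s = K" using K by (auto simp: s_def)
  define u where "u = complex_of_real (1 / s) \<cdot>\<^sub>v (X *\<^sub>v v)"
  have Xv: "X *\<^sub>v v \<in> carrier_vec n" using X v by simp
  show thesis
  proof (rule that[OF s(1) _ v _ vv])
    show "u \<in> carrier_vec n" using Xv by (simp add: u_def)
    have "u \<bullet>c u = complex_of_real (1 / s * (1 / s)) * ((X *\<^sub>v v) \<bullet>c (X *\<^sub>v v))"
      using Xv by (simp add: u_def conjugate_smult_vec)
    also have "\<dots> = complex_of_real (1 / s * (1 / s) * (s * s))"
      by (simp only: XvXv s(2) of_real_mult)
    also have "1 / s * (1 / s) * (s * s) = 1" using s(1) by simp
    finally show "u \<bullet>c u = 1" by simp
    show "X *\<^sub>v v = complex_of_real s \<cdot>\<^sub>v u"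
      using s(1) by (simp add: u_def smult_smult_assoc)
    have "mat_adjoint X *\<^sub>v u = complex_of_real (1 / s) \<cdot>\<^sub>v (e \<cdot>\<^sub>v v)"
      unfolding u_def XX[symmetric] using X Xv by (intro mult_mat_vec) auto
    also have "\<dots> = complex_of_real (1 / s * (s * s)) \<cdot>\<^sub>v v"
      by (simp add: eK s(2) smult_smult_assoc)
    also have "1 / s * (s * s) = s" using s(1) by simp
    finally show "mat_adjoint X *\<^sub>v u = complex_of_real s \<cdot>\<^sub>v v" .
  qed
qed

text \<open>The vector \<open>u\<close> is completed to a basis with \<open>u\<close> in front;
  Gram-Schmidt leaves the first vector unchanged and yields orthogonal nonzero vectors, which are
  then scaled to unit length. As \<open>u\<close> is a unit vector, the scaling preserves the first
  column.\<close>

lemma unitary_completion: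
  fixes u :: "complex vec"
  assumes u: "u \<in> carrier_vec n" and uu: "u \<bullet>c u = 1"
  obtains U where "U \<in> unitary_mats n" "col U 0 = u"
proof -
  interpret cof_vec_space n "TYPE(complex)" .
  have u0: "u \<noteq> 0\<^sub>v n" using uu u conjugate_square_eq_0_vec[OF u] by auto
  have n: "0 < n" using u u0 by (cases n) auto
  define b where "b = basis_completion u"
  note b = basis_completion[OF u u0, folded b_def]
  define ws where "ws = gram_schmidt n b"
  note gs = gram_schmidt_result[OF b(2) b(4) b(5) ws_def]
  have len: "length ws = n" using gs(4) b(6) by simp
  have ws: "ws ! i \<in> carrier_vec n" if "i < n" for i
    using gs(3) len that by (metis nth_mem subsetD)
  have orth: "ws ! j \<bullet>c ws ! i = 0" if "i < n" "j < n" "i \<noteq> j" for i j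
    using corthogonalD[OF gs(2), of j i] len that by auto
  have hd: "ws ! 0 = u"
  proof -
    obtain vs where "b = u # vs" using b(6,7) n by (cases b) auto
    then have "hd ws = u" using u by (simp add: ws_def)
    then show ?thesis using len n by (metis hd_conv_nth length_greater_0_conv)
  qed
  define N where "N i = (\<Sum>k<n. (cmod (ws ! i $ k))\<^sup>2)" for i
  have wN: "ws ! i \<bullet>c ws ! i = complex_of_real (N i)" if "i < n" for i
    using ws[OF that] by (simp add: cscalar_prod_self N_def)
  have N: "0 < N i" if "i < n" for i
  proof -
    have "N i \<noteq> 0"
      using corthogonalD[OF gs(2), of i i] wN len that by auto
    moreover have "0 \<le> N i" by (simp add: N_def sum_nonneg)
    ultimately show ?thesis by simp
  qed
  define U where "U = mat n n (\<lambda>(i, j). ws ! j $ i / complex_of_real (sqrt (N j)))"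
  have U: "U \<in> carrier_mat n n" by (simp add: U_def)
  have "mat_adjoint U * U = 1\<^sub>m n"
  proof (rule eq_matI)
    fix i j assume ij: "i < dim_row (1\<^sub>m n :: complex mat)" "j < dim_col (1\<^sub>m n :: complex mat)"
    then have "(mat_adjoint U * U) $$ (i, j) =
      (\<Sum>k<n. ws ! j $ k * cnj (ws ! i $ k) / complex_of_real (sqrt (N i) * sqrt (N j)))"
      by (simp add: U_def scalar_prod_def atLeast0LessThan mult.commute)
    also have "\<dots> = (ws ! j \<bullet>c ws ! i) / complex_of_real (sqrt (N i) * sqrt (N j))"
      using ij ws[of i] by (simp add: scalar_prod_def atLeast0LessThan sum_divide_distrib)
    also have "\<dots> = 1\<^sub>m n $$ (i, j)"
      using ij orth[of i j] wN[of i] N[of i] by (cases "i = j") auto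
    finally show "(mat_adjoint U * U) $$ (i, j) = 1\<^sub>m n $$ (i, j)" .
  qed (auto simp: U_def)
  moreover from this have "U * mat_adjoint U = 1\<^sub>m n"
    using mat_mult_left_right_inverse[of "mat_adjoint U" n U] U by simp
  ultimately have "U \<in> unitary_mats n" using U by (simp add: unitary_mats_def)
  moreover have "col U 0 = u"
  proof -
    have "N 0 = 1" using wN[OF n] hd uu by (metis of_real_eq_1_iff)
    then show ?thesis using n u hd by (auto simp: U_def)
  qed
  ultimately show thesis by (rule that)
qed

section \<open>Existence of the singular value decomposition\<close>

lemma is_svd_carrier:
  assumes "X \<in> carrier_mat n m"
  shows "is_svd X U S V \<longleftrightarrow> U \<in> unitary_mats n \<and> V \<in> unitary_mats m \<and>
    S \<in> nonneg_diag_mats n m \<and> X = U * map_mat complex_of_real S * mat_adjoint V"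
  using assms by (auto simp: is_svd_def)

lemma nonneg_diag_matsD:
  assumes "S \<in> nonneg_diag_mats n m"
  shows "S \<in> carrier_mat n m" "\<And>i j. i < n \<Longrightarrow> j < m \<Longrightarrow> i \<noteq> j \<Longrightarrow> S $$ (i, j) = 0"
    "\<And>i j. i < n \<Longrightarrow> j < m \<Longrightarrow> 0 \<le> S $$ (i, j)"
  using assms by (auto simp: nonneg_diag_mats_def diagonal_mat_def)

text \<open>The unitary factors are absorbed into \<open>U\<close> and \<open>V\<close>, so
  unitarily equivalent matrices share the diagonal factor \<open>S\<close>.\<close>

lemma is_svd_unitary:
  assumes X: "X \<in> carrier_mat n m" and svd: "is_svd X U S V"
    and A: "A \<in> unitary_mats n" and B: "B \<in> unitary_mats m"
  shows "is_svd (A * X * B) (A * U) S (mat_adjoint B * V)"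
proof -
  have U: "U \<in> unitary_mats n" and V: "V \<in> unitary_mats m" and S: "S \<in> nonneg_diag_mats n m"
    and Xeq: "X = U * map_mat complex_of_real S * mat_adjoint V"
    using svd X by (auto simp: is_svd_carrier)
  note c = unitary_matsD(1)[OF U] unitary_matsD(1)[OF V] unitary_matsD(1)[OF A] unitary_matsD(1)[OF B]
  define T where "T = map_mat complex_of_real S"
  have T: "T \<in> carrier_mat n m" using nonneg_diag_matsD(1)[OF S] by (simp add: T_def)
  have "A * X * B = A * U * T * mat_adjoint (mat_adjoint B * V)"
    unfolding Xeq T_def[symmetric] using c T
    by (simp add: mat_adjoint_mult mat_mult_assoc_dim)
  moreover have "A * X * B \<in> carrier_mat n m"
    using c X by (intro carrier_matI) auto
  ultimately show ?thesis
    using U V A B S by (simp add: is_svd_carrier unitary_mats_mult unitary_mats_adjoint T_def)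
qed

text \<open>This is the assembly step of the induction for existence. The diagonal of
  \<open>S\<close> carries no order, so any nonnegative \<open>s\<close> can be put in
  front.\<close>

lemma is_svd_four_block:
  assumes X: "X \<in> carrier_mat n m" and svd: "is_svd X U S V" and s: "0 \<le> s"
  shows "is_svd (four_block_mat (mat 1 1 (\<lambda>_. complex_of_real s)) (0\<^sub>m 1 m) (0\<^sub>m n 1) X)
    (four_block_mat (1\<^sub>m 1) (0\<^sub>m 1 n) (0\<^sub>m n 1) U)
    (four_block_mat (mat 1 1 (\<lambda>_. s)) (0\<^sub>m 1 m) (0\<^sub>m n 1) S)
    (four_block_mat (1\<^sub>m 1) (0\<^sub>m 1 m) (0\<^sub>m m 1) V)"
    (is "is_svd ?X ?U ?S ?V")
proof -
  have U: "U \<in> unitary_mats n" and V: "V \<in> unitary_mats m" and S: "S \<in> nonneg_diag_mats n m"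
    and Xeq: "X = U * map_mat complex_of_real S * mat_adjoint V"
    using svd X by (auto simp: is_svd_carrier)
  note c = unitary_matsD(1)[OF U] unitary_matsD(1)[OF V] nonneg_diag_matsD(1)[OF S]
  define T where "T = map_mat complex_of_real S"
  have T: "T \<in> carrier_mat n m" using c by (simp add: T_def)
  have S': "map_mat complex_of_real ?S =
      four_block_mat (mat 1 1 (\<lambda>_. complex_of_real s)) (0\<^sub>m 1 m) (0\<^sub>m n 1) T"
    by (rule eq_matI) (use c in \<open>auto simp: T_def\<close>)
  have "?X = ?U * map_mat complex_of_real ?S * mat_adjoint ?V"
    unfolding S' using c T
    by (subst mat_adjoint_four_block_diag[of _ 1 1 _ m m], simp, simp,
        subst mult_four_block_diag[of _ 1 1 _ n n _ 1 _ m], simp, simp, simp, simp,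
        subst mult_four_block_diag[of _ 1 1 _ n m _ 1 _ m], simp, simp, simp, simp)
      (simp add: Xeq T_def)
  moreover have "?S \<in> nonneg_diag_mats (1 + n) (1 + m)"
    using c nonneg_diag_matsD[OF S] s by (auto simp: nonneg_diag_mats_def diagonal_mat_def)
  moreover have "?X \<in> carrier_mat (1 + n) (1 + m)"
    using X by (intro four_block_carrier_mat) auto
  ultimately show ?thesis
    using unitary_mats_four_block_diag[OF unitary_mats_one U, of 1]
      unitary_mats_four_block_diag[OF unitary_mats_one V, of 1]
    by (simp add: is_svd_carrier)
qed

text \<open>Induction on the number of rows. A singular pair of a nonzero \<open>X\<close> is
  completed to unitary matrices \<open>A\<close> and \<open>B\<close>; then
  \<open>mat_adjoint A * X * B\<close> vanishes in the first row and column except for the corner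
  \<open>s\<close>, and the induction hypothesis decomposes the remaining block.\<close>

lemma svd_exists:
  assumes "X \<in> carrier_mat n m"
  shows "\<exists>U S V. is_svd X U S V"
  using assms
proof (induction n arbitrary: m X)
  case 0
  have "is_svd X (1\<^sub>m 0) (0\<^sub>m 0 m) (1\<^sub>m m)"
    using 0 by (auto simp: is_svd_carrier nonneg_diag_mats_def diagonal_mat_def)
  then show ?case by blast
next
  case (Suc n)
  note X = Suc.prems
  show ?case
  proof (cases "X = 0\<^sub>m (Suc n) m")
    case True
    have zero: "map_mat complex_of_real (0\<^sub>m (Suc n) m) = 0\<^sub>m (Suc n) m"
      by (rule eq_matI) auto
    have "is_svd X (1\<^sub>m (Suc n)) (0\<^sub>m (Suc n) m) (1\<^sub>m m)"
      unfolding True by (auto simp: is_svd_def nonneg_diag_mats_def diagonal_mat_def zero)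
    then show ?thesis by blast
  next
    case False
    obtain s u v where s: "0 < (s::real)" and u: "u \<in> carrier_vec (Suc n)" "u \<bullet>c u = 1"
      and v: "v \<in> carrier_vec m" "v \<bullet>c v = 1"
      and Xv: "X *\<^sub>v v = complex_of_real s \<cdot>\<^sub>v u"
      and Xu: "mat_adjoint X *\<^sub>v u = complex_of_real s \<cdot>\<^sub>v v"
      by (rule singular_pair_exists[OF X False])
    \<comment> \<open>A unit vector cannot have dimension 0.\<close>
    obtain m' where m: "m = Suc m'"
      using v by (cases m) (auto simp: scalar_prod_def)
    obtain A where A: "A \<in> unitary_mats (Suc n)" "col A 0 = u"
      using unitary_completion[OF u] by blast
    obtain B where B: "B \<in> unitary_mats m" "col B 0 = v"
      using unitary_completion[OF v] by blast
    note Ac = unitary_matsD[OF A(1)] and Bc = unitary_matsD[OF B(1)]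
    define Z where "Z = mat_adjoint A * X * B"
    have Z: "Z \<in> carrier_mat (Suc n) m" using X Ac Bc by (intro carrier_matI) (auto simp: Z_def)
    \<comment> \<open>The first column of \<open>Z\<close> is \<open>s\<close> times the first unit
      vector, because \<open>X\<close> sends \<open>v\<close> to a multiple of \<open>u\<close> and
      \<open>u\<close> is the first column of \<open>A\<close>.\<close>
    have "col Z 0 = mat_adjoint A * X *\<^sub>v v"
      unfolding Z_def B(2)[symmetric]
      by (rule col_mult2[of _ "Suc n" m B m]) (use X Ac Bc m in \<open>auto intro: carrier_matI\<close>)
    also have "\<dots> = mat_adjoint A *\<^sub>v (X *\<^sub>v v)"
      using X Ac v by (intro assoc_mult_mat_vec) auto
    also have "\<dots> = complex_of_real s \<cdot>\<^sub>v (mat_adjoint A *\<^sub>v col A 0)"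
      unfolding Xv A(2) using Ac u by (intro mult_mat_vec) auto
    also have "mat_adjoint A *\<^sub>v col A 0 = col (1\<^sub>m (Suc n)) 0"
      using Ac by (simp add: col_mult2[of _ "Suc n" "Suc n" A "Suc n", symmetric])
    finally have col0: "col Z 0 $ i = (complex_of_real s \<cdot>\<^sub>v col (1\<^sub>m (Suc n)) 0) $ i" for i
      by simp
    have col0: "Z $$ (i, 0) = (if i = 0 then complex_of_real s else 0)" if "i < Suc n" for i
      using col0[of i] that Z m by (simp del: col_one)
    \<comment> \<open>The first row is read off from the first column of the adjoint, by the second
      equation of the singular pair.\<close>
    have Zadj: "mat_adjoint Z = mat_adjoint B * mat_adjoint X * A"
      using X Ac Bc by (simp add: Z_def mat_adjoint_mult mat_mult_assoc_dim)
    have "col (mat_adjoint Z) 0 = mat_adjoint B * mat_adjoint X *\<^sub>v u"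
      unfolding Zadj A(2)[symmetric]
      by (rule col_mult2[of _ m "Suc n" A "Suc n"]) (use X Ac Bc m in \<open>auto intro: carrier_matI\<close>)
    also have "\<dots> = mat_adjoint B *\<^sub>v (mat_adjoint X *\<^sub>v u)"
      using X Bc u by (intro assoc_mult_mat_vec) auto
    also have "\<dots> = complex_of_real s \<cdot>\<^sub>v (mat_adjoint B *\<^sub>v col B 0)"
      unfolding Xu B(2) using Bc v by (intro mult_mat_vec) auto
    also have "mat_adjoint B *\<^sub>v col B 0 = col (1\<^sub>m m) 0"
      using Bc m by (simp add: col_mult2[of _ m m B m, symmetric])
    finally have row0: "col (mat_adjoint Z) 0 $ j = (complex_of_real s \<cdot>\<^sub>v col (1\<^sub>m m) 0) $ j" for j
      by simp
    have "cnj (Z $$ (0, j)) = cnj (if j = 0 then complex_of_real s else 0)" if "j < m" for j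
      using row0[of j] that Z m by (simp del: col_one)
    then have row0: "Z $$ (0, j) = (if j = 0 then complex_of_real s else 0)" if "j < m" for j
      using that by (simp only: complex_cnj_cancel_iff)
    define X' where "X' = mat n m' (\<lambda>(i, j). Z $$ (Suc i, Suc j))"
    have X': "X' \<in> carrier_mat n m'" by (simp add: X'_def)
    have Zblock: "Z = four_block_mat (mat 1 1 (\<lambda>_. complex_of_real s)) (0\<^sub>m 1 m') (0\<^sub>m n 1) X'"
      by (rule eq_matI) (use Z m col0 row0 in \<open>auto simp: X'_def\<close>)
    obtain U S V where "is_svd X' U S V"
      using Suc.IH[OF X'] by blast
    from is_svd_four_block[OF X' this, of s] obtain U' S' V' where "is_svd Z U' S' V'"
      using s unfolding Zblock by auto
    then have "is_svd (A * Z * mat_adjoint B) (A * U') S' (mat_adjoint (mat_adjoint B) * V')"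
      using is_svd_unitary[OF Z _ A(1) unitary_mats_adjoint[OF B(1)]] by blast
    moreover have "A * Z * mat_adjoint B = X"
      using Ac Bc X
      by (simp add: Z_def mat_mult_assoc_dim unitary_mats_cancel[OF A(1)])
    ultimately show ?thesis
      by auto
  qed
qed

subsection \<open>Projection onto the Schatten ball\<close>

text \<open>Each diagonal entry of \<open>X\<close> is the sum of
  \<open>U $$ (k, j) * S $$ (j, j) * cnj (V $$ (k, j))\<close> over \<open>j\<close>. The triangle
  inequality leaves the weights \<open>cmod (U $$ (k, j)) * cmod (V $$ (k, j))\<close>, which are
  doubly substochastic.\<close>

lemma svd_diag_le:
  assumes q: "1 \<le> q" and X: "X \<in> carrier_mat n1 n2" and svd: "is_svd X U S V"
  shows "lq_norm q (vec (min n1 n2) (\<lambda>k. cmod (X $$ (k, k)))) \<le> lq_norm q (main_diag S)"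
proof -
  define m where "m = min n1 n2"
  have U: "U \<in> unitary_mats n1" and V: "V \<in> unitary_mats n2" and S: "S \<in> nonneg_diag_mats n1 n2"
    and Xeq: "X = U * map_mat complex_of_real S * mat_adjoint V"
    using svd X by (auto simp: is_svd_carrier)
  note c = unitary_matsD(1)[OF U] unitary_matsD(1)[OF V] nonneg_diag_matsD(1)[OF S]
  have m: "m \<le> n1" "m \<le> n2" by (auto simp: m_def)
  have entry: "X $$ (k, k) = (\<Sum>j<m. U $$ (k, j) * complex_of_real (S $$ (j, j)) * cnj (V $$ (k, j)))"
    if k: "k < m" for k
  proof -
    have "X $$ (k, k) =
      (\<Sum>j<n2. (\<Sum>i<n1. U $$ (k, i) * complex_of_real (S $$ (i, j))) * cnj (V $$ (k, j)))"
      unfolding Xeq using c k m by (simp add: scalar_prod_def atLeast0LessThan)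
    \<comment> \<open>A column \<open>j\<close> of \<open>S\<close> with \<open>j \<ge> m\<close>
      contains no diagonal position, so its inner sum is 0.\<close>
    also have "\<dots> = (\<Sum>j<n2. if j < m
        then U $$ (k, j) * complex_of_real (S $$ (j, j)) * cnj (V $$ (k, j)) else 0)"
    proof (rule sum.cong)
      fix j assume j: "j \<in> {..<n2}"
      have "(\<Sum>i<n1. U $$ (k, i) * complex_of_real (S $$ (i, j))) =
        (\<Sum>i<n1. if i = j then U $$ (k, j) * complex_of_real (S $$ (j, j)) else 0)"
        using nonneg_diag_matsD(2)[OF S] j by (intro sum.cong) auto
      then show "(\<Sum>i<n1. U $$ (k, i) * complex_of_real (S $$ (i, j))) * cnj (V $$ (k, j)) =
        (if j < m then U $$ (k, j) * complex_of_real (S $$ (j, j)) * cnj (V $$ (k, j)) else 0)"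
        using j by (simp add: m_def)
    qed simp
    also have "\<dots> = (\<Sum>j\<in>{..<n2} \<inter> {j. j < m}.
        U $$ (k, j) * complex_of_real (S $$ (j, j)) * cnj (V $$ (k, j)))"
      by (simp add: sum.inter_restrict)
    also have "{..<n2} \<inter> {j. j < m} = {..<m}" using m by auto
    finally show ?thesis .
  qed
  define w where "w k j = cmod (U $$ (k, j)) * cmod (V $$ (k, j))" for k j
  show ?thesis unfolding m_def[symmetric]
  proof (rule lq_norm_le_substochastic[where w = w and m = m])
    show "(\<Sum>j<m. w i j) \<le> 1" if "i < m" for i
      unfolding w_def using unitary_mats_weight_le[OF U V m that] .
    \<comment> \<open>Column sums of the weights are row sums of the weights of the
      adjoints.\<close>
    show "(\<Sum>i<m. w i j) \<le> 1" if "j < m" for j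
      using unitary_mats_weight_le[OF unitary_mats_adjoint[OF U] unitary_mats_adjoint[OF V] m that] c m that
      by (simp add: w_def)
    fix k assume k: "k < m"
    have "cmod (X $$ (k, k)) \<le>
      (\<Sum>j<m. cmod (U $$ (k, j) * complex_of_real (S $$ (j, j)) * cnj (V $$ (k, j))))"
      unfolding entry[OF k] by (rule norm_sum)
    also have "\<dots> = (\<Sum>j<m. w k j * \<bar>main_diag S $ j\<bar>)"
      using c m by (intro sum.cong) (auto simp: w_def norm_mult main_diag_def)
    finally show "\<bar>vec m (\<lambda>k. cmod (X $$ (k, k))) $ k\<bar> \<le> (\<Sum>j<m. w k j * \<bar>main_diag S $ j\<bar>)"
      using k by simp
  qed (use q c in \<open>auto simp: w_def main_diag_def m_def\<close>)
qed

text \<open>The decomposition selected for \<open>X\<close> gives one of \<open>A * X * B\<close>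
  with the same diagonal factor, whose diagonal defines the Schatten norm of
  \<open>X\<close>.\<close>

lemma unitary_invariant_diag_le:
  assumes q: "1 \<le> q" and X: "X \<in> carrier_mat n1 n2"
    and A: "A \<in> unitary_mats n1" and B: "B \<in> unitary_mats n2"
  shows "lq_norm q (vec (min n1 n2) (\<lambda>k. cmod ((A * X * B) $$ (k, k)))) \<le> schatten_norm q X"
proof -
  have "\<exists>S U V. is_svd X U S V" using svd_exists[OF X] by blast
  then have "\<exists>U V. is_svd X U (SOME S. \<exists>U V. is_svd X U S V) V"
    by (rule someI_ex)
  then obtain U V where "is_svd X U (SOME S. \<exists>U V. is_svd X U S V) V" by blast
  from is_svd_unitary[OF X this A B] show ?thesis
    unfolding schatten_norm_def singular_values_def
    using X unitary_matsD(1)[OF A] unitary_matsD(1)[OF B]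
    by (intro svd_diag_le[OF q]) (auto intro: carrier_matI)
qed

text \<open>The diagonal factor \<open>T\<close> of the selected decomposition is itself unitarily
  equivalent to \<open>X\<close>, so it has a decomposition with diagonal factor \<open>S\<close>,
  and the diagonal bound applies to \<open>T\<close>.\<close>

lemma schatten_norm_le_svd:
  assumes q: "1 \<le> q" and X: "X \<in> carrier_mat n1 n2" and svd: "is_svd X U S V"
  shows "schatten_norm q X \<le> lq_norm q (main_diag S)"
proof -
  define T where "T = (SOME S. \<exists>U V. is_svd X U S V)"
  have "\<exists>S U V. is_svd X U S V" using svd by blast
  then have "\<exists>U V. is_svd X U T V" unfolding T_def by (rule someI_ex)
  then obtain U' V' where T: "is_svd X U' T V'" by blast
  have U': "U' \<in> unitary_mats n1" and V': "V' \<in> unitary_mats n2" and Tn: "T \<in> nonneg_diag_mats n1 n2"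
    and Xeq: "X = U' * map_mat complex_of_real T * mat_adjoint V'"
    using T X by (auto simp: is_svd_carrier)
  note c = unitary_matsD[OF U'] unitary_matsD[OF V'] nonneg_diag_matsD[OF Tn]
  have "mat_adjoint U' * X * V' = map_mat complex_of_real T"
    using c unfolding Xeq by (simp add: mat_mult_assoc_dim unitary_mats_cancel[OF U'])
  then have "main_diag T = vec (min n1 n2) (\<lambda>k. cmod ((mat_adjoint U' * X * V') $$ (k, k)))"
    using c by (auto simp: main_diag_def)
  moreover have "lq_norm q (vec (min n1 n2) (\<lambda>k. cmod ((mat_adjoint U' * X * V') $$ (k, k)))) \<le>
      lq_norm q (main_diag S)"
    using X c by (intro svd_diag_le[OF q _ is_svd_unitary[OF X svd unitary_mats_adjoint[OF U'] V']])
      (auto intro: carrier_matI)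
  ultimately show ?thesis
    unfolding schatten_norm_def singular_values_def T_def by simp
qed

section \<open>Uniqueness of the vector projection and the Pythagorean inequality\<close>

lemma diag_of_vec_nonneg:
  assumes "\<And>k. k < min n1 n2 \<Longrightarrow> 0 \<le> v $ k"
  shows "diag_of_vec n1 n2 v \<in> nonneg_diag_mats n1 n2"
  using assms by (auto simp: diag_of_vec_def nonneg_diag_mats_def diagonal_mat_def)

lemma main_diag_diag_of_vec:
  "v \<in> carrier_vec (min n1 n2) \<Longrightarrow> main_diag (diag_of_vec n1 n2 v) = v"
  by (auto simp: main_diag_def diag_of_vec_def)

text \<open>Since \<open>arg_min\<close> is a choice operator, uniqueness of the minimiser is what
  determines its value.\<close>

lemma arg_min_eqI:
  assumes "is_arg_min f P x" "\<And>y. is_arg_min f P y \<Longrightarrow> y = x"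
  shows "arg_min f P = x"
  unfolding arg_min_def using assms by (rule some_equality)

text \<open>Expanding the squared distance from \<open>p\<close> to \<open>s\<close> around
  \<open>v\<close> and using the variational inequality at \<open>p\<close> shows that the squared
  distance from \<open>v\<close> to \<open>p\<close> is at most 0.\<close>

lemma lq_ball_closest_unique:
  assumes q: "1 \<le> q" and \<rho>: "0 \<le> \<rho>" and s: "dim_vec s = m"
    and p: "is_arg_min (\<lambda>v. (euclidean_norm (v - s))\<^sup>2) (\<lambda>v. v \<in> lq_ball m q \<rho>) p"
    and v: "is_arg_min (\<lambda>v. (euclidean_norm (v - s))\<^sup>2) (\<lambda>v. v \<in> lq_ball m q \<rho>) v"
  shows "v = p"
proof -
  have dim: "dim_vec p = m" "dim_vec v = m" and vB: "v \<in> lq_ball m q \<rho>" and pB: "p \<in> lq_ball m q \<rho>"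
    using p v by (auto simp: is_arg_min_linorder lq_ball_def)
  have "(\<Sum>i<m. (v $ i - s $ i)\<^sup>2) \<le> (\<Sum>i<m. (p $ i - s $ i)\<^sup>2)"
    using v pB s dim euclidean_norm_diff_sq[of p m s] euclidean_norm_diff_sq[of v m s]
    by (auto simp: is_arg_min_linorder)
  also have "\<dots> = (\<Sum>i<m. (v $ i - s $ i)\<^sup>2 - (v $ i - p $ i)\<^sup>2
      + 2 * ((v $ i - p $ i) * (s $ i - p $ i)))"
    by (intro sum.cong) (auto simp: power2_eq_square algebra_simps)
  also have "\<dots> = (\<Sum>i<m. (v $ i - s $ i)\<^sup>2) - (\<Sum>i<m. (v $ i - p $ i)\<^sup>2)
      + 2 * (\<Sum>i<m. (v $ i - p $ i) * (s $ i - p $ i))"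
    by (simp only: sum.distrib sum_subtractf sum_distrib_left)
  finally have "(\<Sum>i<m. (v $ i - p $ i)\<^sup>2) \<le> 0"
    using lq_ball_closest_variational[OF q \<rho> s p vB] by simp
  then have "(\<Sum>i<m. (v $ i - p $ i)\<^sup>2) = 0"
    by (intro antisym sum_nonneg) auto
  then show ?thesis
    using dim by (auto simp: sum_nonneg_eq_0_iff)
qed

text \<open>Only the real parts of the diagonal of \<open>Z\<close> enter the inner product; since \<open>p \<le> main_diag S\<close>,
  replacing them by the moduli, which form a point of the vector ball, goes in the right direction.\<close>

lemma schatten_ball_pythagoras:
  fixes Z :: "complex mat"
  assumes q: "1 \<le> q" and \<rho>: "0 \<le> \<rho>" and S: "S \<in> nonneg_diag_mats n1 n2"
    and Z: "Z \<in> carrier_mat n1 n2"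
    and Zq: "lq_norm q (vec (min n1 n2) (\<lambda>k. cmod (Z $$ (k, k)))) \<le> \<rho>"
    and p: "is_arg_min (\<lambda>v. (euclidean_norm (v - main_diag S))\<^sup>2)
      (\<lambda>v. v \<in> lq_ball (min n1 n2) q \<rho>) p"
  shows "(frobenius_norm (map_mat complex_of_real (diag_of_vec n1 n2 p) - map_mat complex_of_real S))\<^sup>2
      + (frobenius_norm (Z - map_mat complex_of_real (diag_of_vec n1 n2 p)))\<^sup>2
    \<le> (frobenius_norm (Z - map_mat complex_of_real S))\<^sup>2"
proof -
  define m where "m = min n1 n2"
  define s where "s = main_diag S"
  define z where "z = vec m (\<lambda>k. cmod (Z $$ (k, k)))"
  define P where "P = map_mat complex_of_real (diag_of_vec n1 n2 p)"
  define T where "T = map_mat complex_of_real S"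
  note Sd = nonneg_diag_matsD[OF S]
  have s: "dim_vec s = m" "\<And>k. k < m \<Longrightarrow> s $ k = S $$ (k, k)" "\<And>k. k < m \<Longrightarrow> 0 \<le> s $ k"
    using Sd by (auto simp: s_def m_def main_diag_def)
  note p' = p[folded m_def s_def]
  have "z \<in> lq_ball m q \<rho>"
    using Zq by (auto simp: lq_ball_def z_def m_def)
  then have "(\<Sum>k<m. (z $ k - p $ k) * (s $ k - p $ k)) \<le> 0"
    by (rule lq_ball_closest_variational[OF q \<rho> s(1) p'])
  moreover have "(\<Sum>k<m. (Re (Z $$ (k, k)) - p $ k) * (s $ k - p $ k)) \<le>
      (\<Sum>k<m. (z $ k - p $ k) * (s $ k - p $ k))"
    using lq_ball_closest_le[OF q \<rho> s(1) p'] s(3)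
    by (intro sum_mono mult_right_mono) (auto simp: z_def complex_Re_le_cmod)
  ultimately have var: "(\<Sum>k<m. (Re (Z $$ (k, k)) - p $ k) * (s $ k - p $ k)) \<le> 0"
    by simp
  have PT: "P \<in> carrier_mat n1 n2" "T \<in> carrier_mat n1 n2"
    using Sd(1) by (auto simp: P_def T_def diag_of_vec_def)
  \<comment> \<open>This is the cross term in the expansion of the squared modulus of
    \<open>Z - T\<close> around \<open>P\<close>. It lives on the diagonal, since \<open>P\<close>
    and \<open>T\<close> vanish elsewhere, and its total is nonnegative by
    \<open>var\<close>.\<close>
  define d where "d i j = (if i = j then 2 * ((Re (Z $$ (i, i)) - p $ i) * (p $ i - s $ i)) else 0)" for i j
  have pt: "(cmod (Z $$ (i, j) - T $$ (i, j)))\<^sup>2 =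
      (cmod (P $$ (i, j) - T $$ (i, j)))\<^sup>2 + (cmod (Z $$ (i, j) - P $$ (i, j)))\<^sup>2 + d i j"
    if "i < n1" "j < n2" for i j
  proof (cases "i = j")
    case True
    then have "P $$ (i, j) = complex_of_real (p $ i)" "T $$ (i, j) = complex_of_real (s $ i)"
      using that s(2)[of i] Sd(1) by (auto simp: P_def T_def diag_of_vec_def m_def)
    then show ?thesis
      using True by (simp add: d_def cmod_power2) (simp add: power2_eq_square algebra_simps)
  next
    case False
    then show ?thesis
      using that Sd(1) Sd(2)[of i j] by (simp add: P_def T_def d_def diag_of_vec_def)
  qed
  have "(\<Sum>i<n1. \<Sum>j<n2. d i j) = (\<Sum>k<m. 2 * ((Re (Z $$ (k, k)) - p $ k) * (p $ k - s $ k)))"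
  proof -
    have "(\<Sum>i<n1. \<Sum>j<n2. d i j) =
      (\<Sum>i<n1. if i < n2 then 2 * ((Re (Z $$ (i, i)) - p $ i) * (p $ i - s $ i)) else 0)"
      by (simp add: d_def)
    also have "\<dots> = (\<Sum>i\<in>{..<n1} \<inter> {i. i < n2}. 2 * ((Re (Z $$ (i, i)) - p $ i) * (p $ i - s $ i)))"
      by (simp add: sum.inter_restrict)
    also have "{..<n1} \<inter> {i. i < n2} = {..<m}" by (auto simp: m_def)
    finally show ?thesis .
  qed
  also have "\<dots> = - 2 * (\<Sum>k<m. (Re (Z $$ (k, k)) - p $ k) * (s $ k - p $ k))"
    unfolding sum_distrib_left by (intro sum.cong) (auto simp: algebra_simps)
  finally have d: "0 \<le> (\<Sum>i<n1. \<Sum>j<n2. d i j)"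
    using var by simp
  have "(frobenius_norm (Z - T))\<^sup>2 = (\<Sum>i<n1. \<Sum>j<n2. (cmod (Z $$ (i, j) - T $$ (i, j)))\<^sup>2)"
    using Z PT by (subst frobenius_norm_sq[of _ n1 n2]) auto
  also have "\<dots> = (\<Sum>i<n1. \<Sum>j<n2. (cmod (P $$ (i, j) - T $$ (i, j)))\<^sup>2
      + (cmod (Z $$ (i, j) - P $$ (i, j)))\<^sup>2 + d i j)"
    using pt by (intro sum.cong) auto
  also have "\<dots> = (frobenius_norm (P - T))\<^sup>2 + (frobenius_norm (Z - P))\<^sup>2 + (\<Sum>i<n1. \<Sum>j<n2. d i j)"
    using Z PT frobenius_norm_sq[OF minus_carrier_mat[OF PT(2), of P]]
      frobenius_norm_sq[OF minus_carrier_mat[OF PT(1), of Z]]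
    by (simp add: sum.distrib)
  finally show ?thesis
    using d by (simp add: P_def T_def)
qed

section \<open>Transfer to the Schatten ball along the decomposition of \<open>Y\<close>\<close>

lemma frobenius_norm_eq_0:
  assumes "A \<in> carrier_mat n m" "(frobenius_norm A)\<^sup>2 \<le> 0"
  shows "A = 0\<^sub>m n m"
proof -
  have "(\<Sum>i<n. \<Sum>j<m. (cmod (A $$ (i, j)))\<^sup>2) = 0"
    using assms(2) frobenius_norm_sq[OF assms(1)] by (metis antisym zero_le_power2)
  then have "\<forall>i<n. \<forall>j<m. A $$ (i, j) = 0"
    by (simp add: sum_nonneg_eq_0_iff sum_nonneg)
  then show ?thesis
    using assms(1) by (intro eq_matI) auto
qed

theorem proposition1:
  fixes q :: ereal and \<rho> :: real and n1 n2 :: nat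
    and Y U V :: "complex mat" and S :: "real mat"
  assumes "1 \<le> q" and "\<rho> > 0"
    and "Y \<in> carrier_mat n1 n2"
    and "U \<in> unitary_mats n1" and "V \<in> unitary_mats n2"
    and "S \<in> nonneg_diag_mats n1 n2"
    and "Y = U * map_mat complex_of_real S * mat_adjoint V"
  shows
    "(\<exists>!X. is_arg_min (\<lambda>X. (frobenius_norm (X - Y))\<^sup>2) (\<lambda>X. X \<in> schatten_ball n1 n2 q \<rho>) X) \<and>
     (\<exists>!v. is_arg_min (\<lambda>v. (euclidean_norm (v - main_diag S))\<^sup>2)
            (\<lambda>v. v \<in> lq_ball (min n1 n2) q \<rho>) v) \<and>
     mat_proj (schatten_ball n1 n2 q \<rho>) Y =
       U * map_mat complex_of_real
             (diag_of_vec n1 n2 (vec_proj (lq_ball (min n1 n2) q \<rho>) (main_diag S)))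
         * mat_adjoint V"
proof -
  note q = assms(1) and Y = assms(3) and U = assms(4) and V = assms(5) and S = assms(6)
  have \<rho>: "0 \<le> \<rho>" using assms(2) by simp
  define m where "m = min n1 n2"
  define s where "s = main_diag S"
  define f where "f = (\<lambda>X. (frobenius_norm (X - Y))\<^sup>2)"
  define g where "g = (\<lambda>v. (euclidean_norm (v - s))\<^sup>2)"
  define BX where "BX = (\<lambda>X. X \<in> schatten_ball n1 n2 q \<rho>)"
  define Bv where "Bv = (\<lambda>v. v \<in> lq_ball m q \<rho>)"
  have s: "dim_vec s = m"
    using nonneg_diag_matsD(1)[OF S] by (auto simp: s_def m_def main_diag_def)
  obtain p where p: "is_arg_min g Bv p"
    unfolding g_def Bv_def using lq_ball_closest_exists[OF q \<rho> s] by blast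
  have p_unique: "v = p" if "is_arg_min g Bv v" for v
    using lq_ball_closest_unique[OF q \<rho> s] p that unfolding g_def Bv_def by blast
  have proj: "vec_proj (lq_ball m q \<rho>) s = p"
    unfolding vec_proj_def arg_min_on_def g_def[symmetric] Bv_def[symmetric]
    by (rule arg_min_eqI[OF p p_unique])
  have pB: "p \<in> lq_ball m q \<rho>" using p by (simp add: is_arg_min_linorder Bv_def)
  then have p0: "p \<in> carrier_vec m" "\<And>k. k < m \<Longrightarrow> 0 \<le> p $ k" "lq_norm q p \<le> \<rho>"
    by (auto simp: lq_ball_def)
  define P where "P = map_mat complex_of_real (diag_of_vec n1 n2 p)"
  define T where "T = map_mat complex_of_real S"
  have P: "P \<in> carrier_mat n1 n2" by (simp add: P_def diag_of_vec_def)
  have T: "T \<in> carrier_mat n1 n2" using nonneg_diag_matsD(1)[OF S] by (simp add: T_def)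
  note Uc = unitary_matsD(1)[OF U] and Vc = unitary_matsD(1)[OF V]
  have Yeq: "Y = U * T * mat_adjoint V" using assms(7) by (simp add: T_def)
  define X0 where "X0 = U * P * mat_adjoint V"
  have X0: "X0 \<in> carrier_mat n1 n2"
    using Uc Vc P by (auto simp: X0_def intro: carrier_matI)
  have conj_back: "U * (mat_adjoint U * X * V) * mat_adjoint V = X" if "X \<in> carrier_mat n1 n2" for X
    using that Uc Vc unitary_matsD[OF V] by (simp add: mat_mult_assoc_dim unitary_mats_cancel[OF U])
  \<comment> \<open>Unitary invariance moves distances into the coordinates of the decomposition,
    where \<open>Y\<close> becomes \<open>T\<close> and \<open>X0\<close> becomes
    \<open>P\<close>.\<close>
  have dist: "(frobenius_norm (X - U * A * mat_adjoint V))\<^sup>2 = (frobenius_norm (mat_adjoint U * X * V - A))\<^sup>2"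
    if X: "X \<in> carrier_mat n1 n2" and A: "A \<in> carrier_mat n1 n2" for X A
  proof -
    define Z where "Z = mat_adjoint U * X * V"
    have Z: "Z \<in> carrier_mat n1 n2" using X Uc Vc by (auto simp: Z_def intro: carrier_matI)
    have "X - U * A * mat_adjoint V = U * Z * mat_adjoint V - U * A * mat_adjoint V"
      using conj_back[OF X] by (simp add: Z_def)
    also have "\<dots> = (U * Z - U * A) * mat_adjoint V"
      using Z A Uc Vc by (intro minus_mult_distrib_mat[symmetric]) (auto intro: carrier_matI)
    also have "U * Z - U * A = U * (Z - A)"
      using Z A Uc by (intro mult_minus_distrib_mat[symmetric]) auto
    finally show ?thesis
      using frobenius_norm_unitary[OF U unitary_mats_adjoint[OF V] minus_carrier_mat[OF A, of Z]]
      by (simp add: Z_def)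
  qed
  have X0B: "BX X0"
  proof -
    \<comment> \<open>As \<open>p\<close> is nonnegative, the definition of \<open>X0\<close> is
      already a singular value decomposition, with \<open>p\<close> on the diagonal.\<close>
    have "is_svd X0 U (diag_of_vec n1 n2 p) V"
      using X0 U V diag_of_vec_nonneg[of n1 n2 p] p0(2)
      by (simp add: is_svd_carrier m_def X0_def P_def)
    from schatten_norm_le_svd[OF q X0 this] show ?thesis
      using p0 X0 by (simp add: BX_def schatten_ball_def main_diag_diag_of_vec m_def)
  qed
  \<comment> \<open>Dropping the second square gives minimality of \<open>X0\<close>; keeping it
    forces every other minimiser to coincide with \<open>X0\<close>.\<close>
  have key: "f X0 + (frobenius_norm (X - X0))\<^sup>2 \<le> f X" if "BX X" for X
  proof -
    have X: "X \<in> carrier_mat n1 n2" and Xq: "schatten_norm q X \<le> \<rho>"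
      using that by (auto simp: BX_def schatten_ball_def)
    define Z where "Z = mat_adjoint U * X * V"
    have Z: "Z \<in> carrier_mat n1 n2" using X Uc Vc by (auto simp: Z_def intro: carrier_matI)
    have "lq_norm q (vec (min n1 n2) (\<lambda>k. cmod (Z $$ (k, k)))) \<le> \<rho>"
      using unitary_invariant_diag_le[OF q X unitary_mats_adjoint[OF U] V] Xq by (simp add: Z_def)
    from schatten_ball_pythagoras[OF q \<rho> S Z this p[unfolded g_def Bv_def m_def s_def]]
    have "(frobenius_norm (P - T))\<^sup>2 + (frobenius_norm (Z - P))\<^sup>2 \<le> (frobenius_norm (Z - T))\<^sup>2"
      by (simp add: P_def T_def)
    moreover have "mat_adjoint U * X0 * V = P"
      using Uc Vc P unitary_matsD[OF V] by (simp add: X0_def mat_mult_assoc_dim unitary_mats_cancel[OF U])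
    ultimately show ?thesis
      using dist[OF X T] dist[OF X P] dist[OF X0 T] by (simp add: f_def Yeq X0_def Z_def)
  qed
  have min: "is_arg_min f BX X0"
    unfolding is_arg_min_linorder using X0B key by (smt (verit) zero_le_power2)
  have X_unique: "X = X0" if "is_arg_min f BX X" for X
  proof -
    have BX: "BX X" and "f X \<le> f X0"
      using that X0B by (auto simp: is_arg_min_linorder)
    then have "(frobenius_norm (X - X0))\<^sup>2 \<le> 0"
      using key[OF BX] by linarith
    moreover have X: "X \<in> carrier_mat n1 n2" using BX by (simp add: BX_def schatten_ball_def)
    ultimately have "X - X0 = 0\<^sub>m n1 n2"
      using X0 by (intro frobenius_norm_eq_0) auto
    then have "(X - X0) $$ (i, j) = 0" if "i < n1" "j < n2" for i j
      using that by simp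
    then show ?thesis
      using X X0 by (intro eq_matI) auto
  qed
  have "mat_proj (schatten_ball n1 n2 q \<rho>) Y = X0"
    unfolding mat_proj_def arg_min_on_def f_def[symmetric] BX_def[symmetric]
    by (rule arg_min_eqI[OF min X_unique])
  moreover have "\<exists>!X. is_arg_min f BX X" using min X_unique by blast
  moreover have "\<exists>!v. is_arg_min g Bv v" using p p_unique by blast
  ultimately show ?thesis
    unfolding f_def g_def BX_def Bv_def X0_def P_def proj[symmetric] m_def s_def by blast
qed

end
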